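(* Let $w\in S_n$, let $D\in\mathrm{RPD}(w)$ and let $(i,j),(p,q)$ be movable cross tiles in $D$. Suppose that $(i,j)$ and $(p,q)$ are southwest incomparable. Then $\mathcal{M}_{ij}\circ\mathcal{M}_{pq}(D)=\mathcal{M}_{pq}\circ\mathcal{M}_{ij}(D)$.
   Context: A pipe dream is a finite subset $D\subset \mathbb{Z}_{>0}\times\mathbb{Z}_{>0}$, in matrix coordinates ($(i,j)$ is row $i$ from the top, column $j$ from the left). Place a cross tile at each $(i,j)\in D$ (one strand joins the left and right edges, the other joins the top and bottom edges) and a bump tile at each $(i,j)\notin D$ (one strand joins the top edge to the left edge, the other joins the right edge to the bottom edge). Write $D(i,j)=+$ if $(i,j)\in D$ and $D(i,j)=\bullet$ otherwise. The strands form pipes going from the top boundary to the left boundary; pipe $x$ is the one entering at the top of column $x$. The permutation $w$ of $D$ is defined by: $w(i)$ is the label of the pipe that exits the left boundary in row $i$. Permutations $w\in S_n$ are regarded as permutations of $\mathbb{Z}_{>0}$ fixing all $m>n$. $\mathrm{RPD}(w)$ is the set of reduced pipe dreams for $w$: pipe dreams $D$ whose permutation is $w$ and such that $|D|$ equals the number of inversions of $w$. Generalized ladder move: let $D\in\mathrm{RPD}(w)$, and suppose there are $h<i$ and $j<k$ such that $D(i,j)=+$, $D(h,j)=D(i,k)=D(h,k)=\bullet$, and every other tile in $[h,i]\times[j,k]$ is a $+$. Then $(i,j)$ is called ladder movable in $D$, and $\mathcal{L}_{ij}(D)\in\mathrm{RPD}(w)$ is obtained from $D$ by swapping the tiles at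 $(i,j)$ and $(h,k)$ (given $(i,j)$, the pair $(h,k)$ is unique). Move operators: a cross tile $(i,j)$ of $D$ is movable in $D$ if $D(h,j)=\bullet$ for some $h\in[1,i-1]$. Then put $h_{ij}(D)=\max\{h\in[1,i-1]: D(h,j)=\bullet\}$, $k_{ij}(D)=\min\{k\in[j+1,n]: D(i,k)=\bullet\}$ (which exists), $\mathrm{Rect}_{ij}(D)=[h,i]\times[j,k]$ with $h=h_{ij}(D)$, $k=k_{ij}(D)$, let $a$ be the largest $p\in[h,i)$ such that row $p$ contains a $\bullet$ in $\mathrm{Rect}_{ij}(D)$, and let $b$ be the smallest $q\in(j,k]$ such that column $q$ contains a $\bullet$ in $\mathrm{Rect}_{ij}(D)$. Define $\mathcal{M}_{ij}(D)$ recursively for $(i,j)$ movable in $D$: (i) if $a=h$ and $b=k$, then $(i,j)$ is ladder movable and $\mathcal{M}_{ij}(D)=\mathcal{L}_{ij}(D)$; (ii) if $a>h$, $\mathcal{M}_{ij}(D)=\mathcal{M}_{ij}(\mathcal{M}_{aj}(D))$; (iii) otherwise, $\mathcal{M}_{ij}(D)=\mathcal{M}_{ij}(\mathcal{M}_{ib}(D))$. This recursion is well defined and terminates. Southwest order: $(i,j)\le_{sw}(i',j')$ iff $i\ge i'$ and $j\le j'$. Two positions are southwest incomparable if neither is $\le_{sw}$ the other. (In the situation of the claim, $(i,j)$ is movable in $\mathcal{M}_{pq}(D)$ and $(p,q)$ is movable in $\mathcal{M}_{ij}(D)$, so both sides make sense.) *)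

theory Defs
  imports "HOL-Combinatorics.Permutations"
begin

text \<open>
  A pipe dream is identified with its set of cross tiles, in matrix coordinates (row, column);
  every other position with positive coordinates carries a bump tile.
\<close>

definition pipe_dream :: "(nat \<times> nat) set \<Rightarrow> bool" where
  "pipe_dream D \<longleftrightarrow> finite D \<and> D \<subseteq> {1..} \<times> {1..}"

text \<open>
  Pipes are followed from the top boundary to the left boundary, so a pipe enters each tile
  either through its top edge or through its right edge. A state \<open>(i, 0)\<close> with side \<open>From_Right\<close>
  means that the pipe has left the grid through the left boundary in row \<open>i\<close>.
\<close>

datatype side = From_Top | From_Right

inductive pipe_enters :: "(nat \<times> nat) set \<Rightarrow> nat \<Rightarrow> nat \<Rightarrow> nat \<Rightarrow> side \<Rightarrow> bool"
  for D :: "(nat \<times> nat) set" and x :: nat where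
  start: "1 \<le> x \<Longrightarrow> pipe_enters D x 1 x From_Top"
| cross_top: "pipe_enters D x i (Suc j) From_Top \<Longrightarrow> (i, Suc j) \<in> D \<Longrightarrow>
    pipe_enters D x (Suc i) (Suc j) From_Top"
| bump_top: "pipe_enters D x i (Suc j) From_Top \<Longrightarrow> (i, Suc j) \<notin> D \<Longrightarrow>
    pipe_enters D x i j From_Right"
| cross_right: "pipe_enters D x i (Suc j) From_Right \<Longrightarrow> (i, Suc j) \<in> D \<Longrightarrow>
    pipe_enters D x i j From_Right"
| bump_right: "pipe_enters D x i (Suc j) From_Right \<Longrightarrow> (i, Suc j) \<notin> D \<Longrightarrow>
    pipe_enters D x (Suc i) (Suc j) From_Top"

definition pipe_exits :: "(nat \<times> nat) set \<Rightarrow> nat \<Rightarrow> nat \<Rightarrow> bool" where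
  "pipe_exits D x i \<longleftrightarrow> pipe_enters D x i 0 From_Right"

text \<open>
  Permutations of the positive integers are functions on \<^typ>\<open>nat\<close>; their value at 0 is
  irrelevant here.
\<close>

definition has_permutation :: "(nat \<times> nat) set \<Rightarrow> (nat \<Rightarrow> nat) \<Rightarrow> bool" where
  "has_permutation D w \<longleftrightarrow> (\<forall>i\<ge>1. pipe_exits D (w i) i)"

definition inversions :: "(nat \<Rightarrow> nat) \<Rightarrow> (nat \<times> nat) set" where
  "inversions w = {(x, y). 1 \<le> x \<and> x < y \<and> w y < w x}"

definition RPD :: "(nat \<Rightarrow> nat) \<Rightarrow> (nat \<times> nat) set set" where
  "RPD w = {D. pipe_dream D \<and> has_permutation D w \<and> card D = card (inversions w)}"

definition ladder_corner :: "(nat \<times> nat) set \<Rightarrow> nat \<Rightarrow> nat \<Rightarrow> nat \<Rightarrow> nat \<Rightarrow> bool" where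
  "ladder_corner D i j h k \<longleftrightarrow>
     1 \<le> h \<and> h < i \<and> 1 \<le> j \<and> j < k \<and>
     (i, j) \<in> D \<and> (h, j) \<notin> D \<and> (i, k) \<notin> D \<and> (h, k) \<notin> D \<and>
     {h..i} \<times> {j..k} - {(h, j), (i, k), (h, k)} \<subseteq> D"

definition ladder_movable :: "(nat \<times> nat) set \<Rightarrow> nat \<Rightarrow> nat \<Rightarrow> bool" where
  "ladder_movable D i j \<longleftrightarrow> (\<exists>h k. ladder_corner D i j h k)"

definition ladder_move :: "nat \<Rightarrow> nat \<Rightarrow> (nat \<times> nat) set \<Rightarrow> (nat \<times> nat) set" where
  "ladder_move i j D =
     (let c = (THE c. ladder_corner D i j (fst c) (snd c)) in insert c (D - {(i, j)}))"

definition movable :: "(nat \<times> nat) set \<Rightarrow> nat \<Rightarrow> nat \<Rightarrow> bool" where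
  "movable D i j \<longleftrightarrow> (i, j) \<in> D \<and> (\<exists>h\<in>{1..<i}. (h, j) \<notin> D)"

definition move_h :: "nat \<Rightarrow> nat \<Rightarrow> (nat \<times> nat) set \<Rightarrow> nat" where
  "move_h i j D = Max {h \<in> {1..<i}. (h, j) \<notin> D}"

definition move_k :: "nat \<Rightarrow> nat \<Rightarrow> nat \<Rightarrow> (nat \<times> nat) set \<Rightarrow> nat" where
  "move_k n i j D = Min {k \<in> {j+1..n}. (i, k) \<notin> D}"

definition Rect :: "nat \<Rightarrow> nat \<Rightarrow> nat \<Rightarrow> (nat \<times> nat) set \<Rightarrow> (nat \<times> nat) set" where
  "Rect n i j D = {move_h i j D..i} \<times> {j..move_k n i j D}"

definition move_a :: "nat \<Rightarrow> nat \<Rightarrow> nat \<Rightarrow> (nat \<times> nat) set \<Rightarrow> nat" where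
  "move_a n i j D = Max {p \<in> {move_h i j D..<i}. \<exists>q. (p, q) \<in> Rect n i j D - D}"

definition move_b :: "nat \<Rightarrow> nat \<Rightarrow> nat \<Rightarrow> (nat \<times> nat) set \<Rightarrow> nat" where
  "move_b n i j D = Min {q \<in> {j<..move_k n i j D}. \<exists>p. (p, q) \<in> Rect n i j D - D}"

text \<open>
  The move operator is a partial operator on pipe dreams: the value \<^const>\<open>None\<close> means that it is
  undefined, i.e. that some position to be moved is not movable, that the first case is reached at
  a position that is not ladder movable, or that the recursion does not terminate
  (\<open>partial_function\<close> yields the least solution of the recursion equation). Thus
  \<open>move_op n i j D = Some E\<close> says that the recursion terminates with result \<open>E\<close>.
\<close>

partial_function (option)
  move_op :: "nat \<Rightarrow> nat \<Rightarrow> nat \<Rightarrow> (nat \<times> nat) set \<Rightarrow> (nat \<times> nat) set option" where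
  "move_op n i j D =
     (if \<not> movable D i j then None
      else if move_a n i j D = move_h i j D \<and> move_b n i j D = move_k n i j D then
        (if ladder_movable D i j then Some (ladder_move i j D) else None)
      else if move_a n i j D > move_h i j D then
        Option.bind (move_op n (move_a n i j D) j D) (move_op n i j)
      else
        Option.bind (move_op n i (move_b n i j D) D) (move_op n i j))"

definition sw_le :: "nat \<times> nat \<Rightarrow> nat \<times> nat \<Rightarrow> bool" where
  "sw_le c c' \<longleftrightarrow> fst c \<ge> fst c' \<and> snd c \<le> snd c'"

definition sw_incomparable :: "nat \<times> nat \<Rightarrow> nat \<times> nat \<Rightarrow> bool" where
  "sw_incomparable c c' \<longleftrightarrow> \<not> sw_le c c' \<and> \<not> sw_le c' c"

end

theory Submission
  imports Defs
begin

text \<open>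
  Order grids by sequences of ladder moves. The result of the move operator at \<open>(i, j)\<close> is the least
  grid that can be reached from \<open>D\<close> by moving \<open>(i, j)\<close>, provided that only positions in a set \<open>W\<close> are
  moved, where \<open>W\<close> is closed under going northeast and \<open>(i, j)\<close> is southwest minimal in \<open>W\<close>. For
  incomparable positions \<open>(i, j)\<close> and \<open>(p, q)\<close>, let \<open>W\<close> be the positions northeast of at least one of them.
  Each of the two composites is reached inside \<open>W\<close> by moving both crosses, so by leastness each lies
  below the other.

  Leastness follows from monotonicity of the operator under a single ladder move, by Noetherian
  induction on the ladder order. For this, the recursion is unrolled into ladder moves at a
  ``pivot'' that is read off directly from the grid. The reflection in the antidiagonal exchanges
  the roles of rows and columns and gives a second choice of pivot; in every configuration one of
  the two pivots interacts with the given ladder move in a harmless way.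

  Reducedness enters only through the absence of rectangles in which two pipes would cross twice.
\<close>

subsection \<open>Ladder moves on integer grids\<close>

text \<open>The recursion behind \<open>move_op\<close> is nested, and a move elsewhere changes the
  rectangles of its inner calls, so the two composites are hard to compare call by call. In the flat
  sequence of ladder moves only one rectangle at a time matters. A ladder move from
  \<open>(x, y)\<close> to \<open>(g, z)\<close> can fail to commute with a different pivot move
  from \<open>(r, b)\<close> to \<open>(h, k)\<close> in four ways: \<open>(h, k)\<close> is the
  lower right or the upper left bump of the ladder, or \<open>(g, z)\<close> is
  \<open>(h, b)\<close> or \<open>(r, k)\<close>. In the first and the third the diagram is closed
  by rerouting crosses. The other two are their reflections, and there the reflected pivot turns out
  to be harmless. Monotonicity concerns moved crosses that are not weakly southwest of
  \<open>(i, j)\<close>. Incomparability makes both positions southwest minimal in one common set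
  \<open>W\<close>. Comparison paths are kept inside \<open>W\<close> because leastness is applied a
  second time to such a path.\<close>

definition ladder :: "(int \<times> int) set \<Rightarrow> int \<Rightarrow> int \<Rightarrow> int \<Rightarrow> int \<Rightarrow> bool" where
  "ladder G i j h k \<longleftrightarrow> h < i \<and> j < k \<and> (i, j) \<in> G \<and> (h, j) \<notin> G \<and> (i, k) \<notin> G \<and> (h, k) \<notin> G \<and>
     (\<forall>x y. h \<le> x \<longrightarrow> x \<le> i \<longrightarrow> j \<le> y \<longrightarrow> y \<le> k \<longrightarrow> (x, y) \<notin> {(h, j), (i, k), (h, k)} \<longrightarrow> (x, y) \<in> G)"

definition shift :: "(int \<times> int) set \<Rightarrow> int \<Rightarrow> int \<Rightarrow> int \<Rightarrow> int \<Rightarrow> (int \<times> int) set" where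
  "shift G i j h k = insert (h, k) (G - {(i, j)})"

definition step :: "(int \<times> int) set \<Rightarrow> (int \<times> int) set \<Rightarrow> (int \<times> int) set \<Rightarrow> bool" where
  "step W G G' \<longleftrightarrow> (\<exists>i j h k. (i, j) \<in> W \<and> ladder G i j h k \<and> G' = shift G i j h k)"

abbreviation steps :: "(int \<times> int) set \<Rightarrow> (int \<times> int) set \<Rightarrow> (int \<times> int) set \<Rightarrow> bool" where
  "steps W \<equiv> (step W)\<^sup>*\<^sup>*"

text \<open>One pipe follows the top row and the left column of the rectangle, another the right
  column and the bottom row. They cross at \<open>(i, j)\<close>, so a cross at
  \<open>(h, k)\<close> would be their second crossing.\<close>

definition no_double_crossing :: "(int \<times> int) set \<Rightarrow> bool" where
  "no_double_crossing G \<longleftrightarrow> (\<forall>h i j k. h < i \<longrightarrow> j < k \<longrightarrow> (i, j) \<in> G \<longrightarrow> (h, j) \<notin> G \<longrightarrow> (i, k) \<notin> G \<longrightarrow>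
     (\<forall>x y. h \<le> x \<longrightarrow> x \<le> i \<longrightarrow> j \<le> y \<longrightarrow> y \<le> k \<longrightarrow> (x, y) \<notin> {(h, j), (i, k), (h, k)} \<longrightarrow> (x, y) \<in> G) \<longrightarrow>
     (h, k) \<notin> G)"

text \<open>
  Besides being hereditary, admissibility provides the Noetherian induction: being inductive, it rules
  out infinite sequences of ladder moves.
\<close>

inductive admissible :: "(int \<times> int) set \<Rightarrow> bool" where
  admissibleI: "no_double_crossing G \<Longrightarrow> (\<And>G'. step UNIV G G' \<Longrightarrow> admissible G') \<Longrightarrow> admissible G"

text \<open>
  Here \<open>h\<close> is the row of the first bump above \<open>(i, j)\<close>, \<open>k\<close> is the least column right of \<open>j\<close> with a bump
  in the rows \<open>{h<..i}\<close>, \<open>r\<close> is the topmost such row with a bump in column \<open>k\<close>, and \<open>b\<close> is the last column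
  before \<open>k\<close> with a bump in row \<open>h\<close>. The recursion for \<open>(i, j)\<close> starts with the ladder move
  from \<open>(r, b)\<close> to \<open>(h, k)\<close>.
\<close>

definition pivot :: "(int \<times> int) set \<Rightarrow> int \<Rightarrow> int \<Rightarrow> int \<Rightarrow> int \<Rightarrow> int \<Rightarrow> int \<Rightarrow> bool" where
  "pivot G i j h r b k \<longleftrightarrow> h < r \<and> r \<le> i \<and> j \<le> b \<and> b < k \<and> (h, j) \<notin> G \<and> (h, b) \<notin> G \<and> (r, k) \<notin> G \<and>
     (\<forall>x y. h < x \<longrightarrow> x \<le> i \<longrightarrow> j \<le> y \<longrightarrow> y < k \<longrightarrow> (x, y) \<in> G) \<and>
     (\<forall>x. h < x \<longrightarrow> x < r \<longrightarrow> (x, k) \<in> G) \<and> (\<forall>y. b < y \<longrightarrow> y < k \<longrightarrow> (h, y) \<in> G)"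

text \<open>A relation can be stated before termination is known. The pivot is recomputed in each
  current grid, and the move of \<open>(i, j)\<close> itself comes last.\<close>

inductive moves :: "int \<Rightarrow> int \<Rightarrow> (int \<times> int) set \<Rightarrow> (int \<times> int) set \<Rightarrow> bool" for i j where
  moves_last: "pivot G i j h i j k \<Longrightarrow> moves i j G (shift G i j h k)"
| moves_step: "pivot G i j h r b k \<Longrightarrow> (r, b) \<noteq> (i, j) \<Longrightarrow> moves i j (shift G r b h k) E \<Longrightarrow> moves i j G E"

text \<open>Asking for a bump on both sides makes the notion invariant under the reflection; on
  reduced pipe dreams it matches \<open>movable\<close>.\<close>

definition unblocked :: "(int \<times> int) set \<Rightarrow> int \<Rightarrow> int \<Rightarrow> bool" where
  "unblocked G i j \<longleftrightarrow> (i, j) \<in> G \<and> (\<exists>h<i. (h, j) \<notin> G) \<and> (\<exists>k>j. (i, k) \<notin> G)"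

lemma mem_shift: "(x, y) \<in> shift G i j h k \<longleftrightarrow> (x = h \<and> y = k) \<or> ((x, y) \<in> G \<and> \<not> (x = i \<and> y = j))"
  by (auto simp: shift_def)

lemma ladder_hole:
  assumes "ladder G i j h k" "(x, y) \<notin> G" "h \<le> x" "x \<le> i" "j \<le> y" "y \<le> k"
  shows "(x = h \<and> y = j) \<or> (x = i \<and> y = k) \<or> (x = h \<and> y = k)"
  using assms unfolding ladder_def by auto

lemma ladderD:
  assumes "ladder G i j h k"
  shows "h < i" "j < k" "(i, j) \<in> G" "(h, j) \<notin> G" "(i, k) \<notin> G" "(h, k) \<notin> G"
  using assms unfolding ladder_def by auto

lemma ladder_unique:
  assumes "ladder G i j h k" "ladder G i j h' k'"
  shows "h' = h \<and> k' = k"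
proof -
  have "h' = h"
  proof (cases h h' rule: linorder_cases)
    case less
    then show ?thesis using ladder_hole[OF assms(1), of h' j] ladderD[OF assms(1)] ladderD[OF assms(2)] by auto
  next
    case greater
    then show ?thesis using ladder_hole[OF assms(2), of h j] ladderD[OF assms(1)] ladderD[OF assms(2)] by auto
  qed auto
  moreover have "k' = k"
  proof (cases k k' rule: linorder_cases)
    case less
    then show ?thesis using ladder_hole[OF assms(2), of i k] ladderD[OF assms(1)] ladderD[OF assms(2)] by auto
  next
    case greater
    then show ?thesis using ladder_hole[OF assms(1), of i k'] ladderD[OF assms(1)] ladderD[OF assms(2)] by auto
  qed auto
  ultimately show ?thesis by simp
qed

lemma pivotD:
  assumes "pivot G i j h r b k"
  shows "h < r" "r \<le> i" "j \<le> b" "b < k" "(h, j) \<notin> G" "(h, b) \<notin> G" "(r, k) \<notin> G"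
  using assms unfolding pivot_def by auto

lemma pivot_full:
  assumes "pivot G i j h r b k" "h < x" "x \<le> i" "j \<le> y" "y < k"
  shows "(x, y) \<in> G"
  using assms unfolding pivot_def by auto

lemma pivot_col:
  assumes "pivot G i j h r b k" "h < x" "x < r"
  shows "(x, k) \<in> G"
  using assms unfolding pivot_def by auto

lemma pivot_row:
  assumes "pivot G i j h r b k" "b < y" "y < k"
  shows "(h, y) \<in> G"
  using assms unfolding pivot_def by auto

lemma pivot_unique:
  assumes 1: "pivot G i j h r b k" and 2: "pivot G i j h' r' b' k'"
  shows "h' = h \<and> r' = r \<and> b' = b \<and> k' = k"
proof -
  note d1 = pivotD[OF 1] and d2 = pivotD[OF 2]
  have h: "h' = h"
  proof (cases h h' rule: linorder_cases)
    case less
    then show ?thesis using pivot_full[OF 1, of h' j] d1 d2 by auto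
  next
    case greater
    then show ?thesis using pivot_full[OF 2, of h j] d1 d2 by auto
  qed auto
  have k: "k' = k"
  proof (cases k k' rule: linorder_cases)
    case less
    then show ?thesis using pivot_full[OF 2, of r k] d1 d2 h by auto
  next
    case greater
    then show ?thesis using pivot_full[OF 1, of r' k'] d1 d2 h by auto
  qed auto
  have r: "r' = r"
  proof (cases r r' rule: linorder_cases)
    case less
    then show ?thesis using pivot_col[OF 2, of r] d1 d2 h k by auto
  next
    case greater
    then show ?thesis using pivot_col[OF 1, of r'] d1 d2 h k by auto
  qed auto
  have "b' = b"
  proof (cases b b' rule: linorder_cases)
    case less
    then show ?thesis using pivot_row[OF 1, of b'] d1 d2 h k by auto
  next
    case greater
    then show ?thesis using pivot_row[OF 2, of b] d1 d2 h k by auto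
  qed auto
  with h k r show ?thesis by simp
qed

text \<open>The fullness clauses of the pivot supply every cross of the rectangle; the bump at
  \<open>(h, k)\<close> has to come from \<open>no_double_crossing\<close>.\<close>

lemma pivot_ladder:
  assumes p: "pivot G i j h r b k" and "no_double_crossing G"
  shows "ladder G r b h k"
proof -
  note d = pivotD[OF p]
  have full: "(x, y) \<in> G" if "h \<le> x" "x \<le> r" "b \<le> y" "y \<le> k" "(x, y) \<notin> {(h, b), (r, k), (h, k)}" for x y
  proof (cases "x = h")
    case True
    then show ?thesis using that pivot_row[OF p, of y] by auto
  next
    case False
    then show ?thesis
      using that d pivot_full[OF p, of x y] pivot_col[OF p, of x] by (cases "y = k") auto
  qed
  have rb: "(r, b) \<in> G" using pivot_full[OF p, of r b] d by auto
  have "(h, k) \<notin> G"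
    using assms(2) full d rb unfolding no_double_crossing_def by blast
  with full d rb show ?thesis unfolding ladder_def by auto
qed

lemma ladder_pivot: "ladder G i j h k \<Longrightarrow> pivot G i j h i j k"
  unfolding ladder_def pivot_def by auto

lemma admissible_cases:
  assumes "admissible G"
  shows "no_double_crossing G" "ladder G i j h k \<Longrightarrow> admissible (shift G i j h k)"
proof -
  show "no_double_crossing G" using assms by cases
  assume "ladder G i j h k"
  then have "step UNIV G (shift G i j h k)" unfolding step_def by blast
  with assms show "admissible (shift G i j h k)" by cases
qed

lemma int_greatest:
  fixes P :: "int \<Rightarrow> bool"
  assumes "P x" "x < i"
  shows "\<exists>h. P h \<and> x \<le> h \<and> h < i \<and> (\<forall>y. h < y \<longrightarrow> y < i \<longrightarrow> \<not> P y)"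
proof -
  let ?S = "{y. x \<le> y \<and> y < i \<and> P y}"
  have fin: "finite ?S" by (rule finite_subset[of _ "{x..<i}"]) auto
  have mem: "x \<in> ?S" using assms by auto
  have m: "Max ?S \<in> ?S" using Max_in[OF fin] mem by blast
  have "\<not> P y" if "Max ?S < y" "y < i" for y
    using that Max_ge[OF fin, of y] m by force
  then show ?thesis using m by blast
qed

lemma int_least:
  fixes P :: "int \<Rightarrow> bool"
  assumes "P x" "j < x"
  shows "\<exists>k. P k \<and> j < k \<and> k \<le> x \<and> (\<forall>y. j < y \<longrightarrow> y < k \<longrightarrow> \<not> P y)"
proof -
  obtain h where h: "P (- h)" "h < - j" "- x \<le> h" "\<forall>y. h < y \<longrightarrow> y < - j \<longrightarrow> \<not> P (- y)"
    using int_greatest[of "\<lambda>y. P (- y)" "- x" "- j"] assms by auto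
  have "\<not> P y" if "j < y" "y < - h" for y
    using h(4)[rule_format, of "- y"] that by simp
  then show ?thesis using h(1-3) by (intro exI[of _ "- h"]) auto
qed

lemma unblocked_pivot:
  assumes "unblocked G i j"
  shows "\<exists>h r b k. pivot G i j h r b k"
proof -
  obtain h0 k0 where h0: "(h0, j) \<notin> G" "h0 < i" and k0: "k0 > j" "(i, k0) \<notin> G" and ij: "(i, j) \<in> G"
    using assms unfolding unblocked_def by auto
  obtain h where h: "(h, j) \<notin> G" "h < i" "\<forall>y. h < y \<longrightarrow> y < i \<longrightarrow> \<not> (y, j) \<notin> G"
    using int_greatest[of "\<lambda>x. (x, j) \<notin> G", OF h0] by auto
  obtain k where k: "\<exists>x. h < x \<and> x \<le> i \<and> (x, k) \<notin> G" "j < k"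
    "\<forall>y. j < y \<longrightarrow> y < k \<longrightarrow> \<not> (\<exists>x. h < x \<and> x \<le> i \<and> (x, y) \<notin> G)"
    using int_least[of "\<lambda>y. \<exists>x. h < x \<and> x \<le> i \<and> (x, y) \<notin> G", OF exI[of _ i] k0(1)] k0 h(2) by auto
  obtain x0 where x0: "h < x0" "x0 \<le> i" "(x0, k) \<notin> G" using k(1) by blast
  obtain r where r: "(r, k) \<notin> G" "h < r" "r \<le> x0" "\<forall>y. h < y \<longrightarrow> y < r \<longrightarrow> \<not> (y, k) \<notin> G"
    using int_least[of "\<lambda>x. (x, k) \<notin> G", OF x0(3,1)] by auto
  obtain b where b: "(h, b) \<notin> G" "j \<le> b" "b < k" "\<forall>y. b < y \<longrightarrow> y < k \<longrightarrow> \<not> (h, y) \<notin> G"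
    using int_greatest[of "\<lambda>y. (h, y) \<notin> G", OF h(1) k(2)] by auto
  have full: "(x, y) \<in> G" if "h < x" "x \<le> i" "j \<le> y" "y < k" for x y
    using that k(3)[rule_format, of y] h(3)[rule_format, of x] ij by (cases "y = j"; cases "x = i") auto
  have "pivot G i j h r b k"
    unfolding pivot_def using r b h x0 full by auto
  then show ?thesis by blast
qed

text \<open>An arbitrary bump above or to the right may get filled, so the nearest ones are taken. A
  cross landing on the nearest bump above starts left of column \<open>j\<close>, hence above row
  \<open>i\<close>, and the lower right bump of its ladder would be a nearer bump.\<close>

lemma unblocked_shift:
  assumes l: "ladder G x y g z" and "unblocked G i j" "x < i \<or> j < y"
  shows "unblocked (shift G x y g z) i j"
proof -
  note d = ladderD[OF l]
  obtain h0 where h0: "(h0, j) \<notin> G" "h0 < i" and ij: "(i, j) \<in> G" using assms(2) unfolding unblocked_def by blast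
  obtain k0 where k0: "k0 > j" "(i, k0) \<notin> G" using assms(2) unfolding unblocked_def by blast
  obtain h where h: "(h, j) \<notin> G" "h < i" "\<forall>y. h < y \<longrightarrow> y < i \<longrightarrow> \<not> (y, j) \<notin> G"
    using int_greatest[of "\<lambda>x. (x, j) \<notin> G", OF h0] by auto
  obtain k where k: "(i, k) \<notin> G" "j < k" "\<forall>y. j < y \<longrightarrow> y < k \<longrightarrow> \<not> (i, y) \<notin> G"
    using int_least[of "\<lambda>y. (i, y) \<notin> G", OF k0(2,1)] by auto
  have "\<not> (g = h \<and> z = j)" using h(3)[rule_format, of x] ij d assms(3) by (cases "x = i") auto
  moreover have "\<not> (g = i \<and> z = k)" using k(3)[rule_format, of y] ij d assms(3) by (cases "y = j") auto
  ultimately have "(h, j) \<notin> shift G x y g z" "(i, k) \<notin> shift G x y g z" "(i, j) \<in> shift G x y g z"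
    using h k ij assms(3) by (auto simp: mem_shift)
  with h k show ?thesis unfolding unblocked_def by blast
qed

section \<open>Determinacy, existence and first properties of the evaluation\<close>

lemma moves_pivot_step:
  assumes "moves i j G E" "pivot G i j h r b k"
  shows "if (r, b) = (i, j) then E = shift G i j h k else moves i j (shift G r b h k) E"
proof -
  have *: "(\<exists>h' k'. pivot G i j h' i j k' \<and> E = shift G i j h' k') \<or>
    (\<exists>h' r' b' k'. pivot G i j h' r' b' k' \<and> (r', b') \<noteq> (i, j) \<and> moves i j (shift G r' b' h' k') E)"
    using assms(1) by (cases rule: moves.cases) blast+
  show ?thesis
  proof (cases "\<exists>h' k'. pivot G i j h' i j k' \<and> E = shift G i j h' k'")
    case True
    then obtain h' k' where p: "pivot G i j h' i j k'" and E: "E = shift G i j h' k'" by blast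
    from pivot_unique[OF assms(2) p] E show ?thesis by (elim conjE) simp
  next
    case False
    then obtain h' r' b' k' where p: "pivot G i j h' r' b' k'" "(r', b') \<noteq> (i, j)"
      and E: "moves i j (shift G r' b' h' k') E" using * by blast
    from pivot_unique[OF assms(2) p(1)] p(2) E show ?thesis by (elim conjE) auto
  qed
qed

lemma moves_unique:
  assumes "moves i j G E" "moves i j G E'"
  shows "E' = E"
  using assms
proof (induction arbitrary: E' rule: moves.induct)
  case (moves_last G h k)
  from moves_pivot_step[OF moves_last(2,1)] show ?case by simp
next
  case (moves_step G h r b k E)
  from moves_pivot_step[OF moves_step.prems moves_step.hyps(1)] moves_step.hyps(2)
  have "moves i j (shift G r b h k) E'" by (simp only: if_False)
  then show ?case by (rule moves_step.IH)
qed

lemma moves_exists: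
  assumes "admissible G" "unblocked G i j"
  shows "\<exists>E. moves i j G E"
  using assms
proof (induction rule: admissible.induct)
  case (admissibleI G)
  obtain h r b k where p: "pivot G i j h r b k" using unblocked_pivot[OF admissibleI(4)] by auto
  have l: "ladder G r b h k" using pivot_ladder[OF p] admissibleI(1) .
  show ?case
  proof (cases "(r, b) = (i, j)")
    case True
    then show ?thesis using p moves_last[of G i j h k] by auto
  next
    case False
    have "unblocked (shift G r b h k) i j"
      using unblocked_shift[OF l admissibleI(4)] False pivotD[OF p] by auto
    moreover have "step UNIV G (shift G r b h k)" unfolding step_def using l by blast
    ultimately obtain E where "moves i j (shift G r b h k) E" using admissibleI(3) by blast
    then show ?thesis using moves_step[OF p False] by blast
  qed
qed

lemma moves_props:
  assumes "moves i j G E" "admissible G"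
  shows "admissible E" "(i, j) \<notin> E" "steps ({..i} \<times> {j..}) G E" "(i, j) \<in> G"
proof -
  have "admissible E \<and> (i, j) \<notin> E \<and> steps ({..i} \<times> {j..}) G E \<and> (i, j) \<in> G"
    using assms
  proof (induction rule: moves.induct)
    case (moves_last G h k)
    have l: "ladder G i j h k" using pivot_ladder moves_last admissible_cases by blast
    then have "step ({..i} \<times> {j..}) G (shift G i j h k)" unfolding step_def by auto
    then show ?case using l admissible_cases(2)[OF moves_last(2) l] ladderD[OF l] by (auto simp: mem_shift)
  next
    case (moves_step G h r b k E)
    have l: "ladder G r b h k" using pivot_ladder moves_step admissible_cases by blast
    then have "step ({..i} \<times> {j..}) G (shift G r b h k)"
      unfolding step_def using pivotD[OF moves_step(1)] by auto
    moreover have "(i, j) \<in> G" using pivotD[OF moves_step(1)] pivot_full[OF moves_step(1)] by auto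
    ultimately show ?case using moves_step.IH admissible_cases(2)[OF moves_step.prems l]
      by (meson converse_rtranclp_into_rtranclp)
  qed
  then show "admissible E" "(i, j) \<notin> E" "steps ({..i} \<times> {j..}) G E" "(i, j) \<in> G" by auto
qed

subsection \<open>Reflection in the antidiagonal\<close>

text \<open>Swapping and negating the coordinates keeps southwest corners southwest and exchanges
  the upper left with the lower right corner, so ladder moves go to ladder moves. The negative
  values are one reason for integer grids.\<close>

definition mirror :: "(int \<times> int) set \<Rightarrow> (int \<times> int) set" where
  "mirror G = {(x, y). (- y, - x) \<in> G}"

lemma mem_mirror [simp]: "(x, y) \<in> mirror G \<longleftrightarrow> (- y, - x) \<in> G"
  by (simp add: mirror_def)

lemma mirror_mirror [simp]: "mirror (mirror G) = G"
  by (auto simp: mirror_def)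

lemma mirror_shift: "mirror (shift G i j h k) = shift (mirror G) (- j) (- i) (- k) (- h)"
  by (auto simp: mirror_def shift_def)

lemma ladder_mirror_imp: "ladder G i j h k \<Longrightarrow> ladder (mirror G) (- j) (- i) (- k) (- h)"
proof -
  assume l: "ladder G i j h k"
  have "(x, y) \<in> mirror G" if "- k \<le> x" "x \<le> - j" "- i \<le> y" "y \<le> - h"
    "(x, y) \<notin> {(- k, - i), (- j, - h), (- k, - h)}" for x y
  proof -
    have "- y \<noteq> h \<or> - x \<noteq> j" "- y \<noteq> i \<or> - x \<noteq> k" "- y \<noteq> h \<or> - x \<noteq> k"
      using that(5) by auto
    moreover have "h \<le> - y" "- y \<le> i" "j \<le> - x" "- x \<le> k" using that by auto
    ultimately show ?thesis using ladder_hole[OF l, of "- y" "- x"] by fastforce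
  qed
  then show ?thesis
    using ladderD[OF l] unfolding ladder_def by simp
qed

lemma step_mirror_imp: "step W G G' \<Longrightarrow> step (mirror W) (mirror G) (mirror G')"
proof -
  assume "step W G G'"
  then obtain i j h k where "(i, j) \<in> W" "ladder G i j h k" "G' = shift G i j h k"
    unfolding step_def by blast
  then show ?thesis
    unfolding step_def
    by (intro exI[of _ "- j"] exI[of _ "- i"] exI[of _ "- k"] exI[of _ "- h"])
      (simp add: ladder_mirror_imp mirror_shift)
qed

lemma no_double_crossing_mirror:
  assumes "no_double_crossing G"
  shows "no_double_crossing (mirror G)"
  unfolding no_double_crossing_def
proof (intro allI impI)
  fix h i j k :: int
  assume a: "h < i" "j < k" "(i, j) \<in> mirror G" "(h, j) \<notin> mirror G" "(i, k) \<notin> mirror G"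
    and full: "\<forall>x y. h \<le> x \<longrightarrow> x \<le> i \<longrightarrow> j \<le> y \<longrightarrow> y \<le> k \<longrightarrow> (x, y) \<notin> {(h, j), (i, k), (h, k)} \<longrightarrow> (x, y) \<in> mirror G"
  have "(x, y) \<in> G" if "- k \<le> x" "x \<le> - j" "- i \<le> y" "y \<le> - h" "(x, y) \<notin> {(- k, - i), (- j, - h), (- k, - h)}" for x y
    using full[rule_format, of "- y" "- x"] that by auto
  moreover have "- k < - j" "- i < - h" "(- j, - i) \<in> G" "(- k, - i) \<notin> G" "(- j, - h) \<notin> G" using a by auto
  ultimately have "(- k, - h) \<notin> G" using assms unfolding no_double_crossing_def by blast
  then show "(h, k) \<notin> mirror G" by simp
qed

lemma steps_mirror_imp: "steps W G G' \<Longrightarrow> steps (mirror W) (mirror G) (mirror G')"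
proof (induction rule: rtranclp_induct)
  case (step G' G'')
  then show ?case using step_mirror_imp[OF step(2)] by (meson rtranclp.rtrancl_into_rtrancl)
qed simp

lemma admissible_mirror: "admissible G \<Longrightarrow> admissible (mirror G)"
proof (induction rule: admissible.induct)
  case (admissibleI G)
  show ?case
  proof (rule admissible.admissibleI)
    fix G' assume "step UNIV (mirror G) G'"
    then have "step (mirror UNIV) G (mirror G')" using step_mirror_imp by fastforce
    moreover have "mirror UNIV = UNIV" by (auto simp: mirror_def)
    ultimately show "admissible G'" using admissibleI(3) by fastforce
  qed (use admissibleI no_double_crossing_mirror in auto)
qed

lemma unblocked_mirror:
  assumes "unblocked G i j"
  shows "unblocked (mirror G) (- j) (- i)"
proof -
  obtain h k where "h < i" "(h, j) \<notin> G" "j < k" "(i, k) \<notin> G" "(i, j) \<in> G"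
    using assms unfolding unblocked_def by auto
  then show ?thesis unfolding unblocked_def
    by (intro conjI exI[of _ "- h"] exI[of _ "- k"]) auto
qed

text \<open>The hypothesis covers grids at any positive distance, since
  \<open>steps_pivot_upper_left\<close> uses it two moves further on.\<close>

lemma admissible_induct [consumes 1, case_names step]:
  assumes "admissible G" and "\<And>G. admissible G \<Longrightarrow> (\<And>G'. (step UNIV)\<^sup>+\<^sup>+ G G' \<Longrightarrow> P G') \<Longrightarrow> P G"
  shows "P G"
proof -
  have "\<forall>G'. steps UNIV G G' \<longrightarrow> P G'"
    using assms(1)
  proof (induction rule: admissible.induct)
    case (admissibleI G)
    have later: "P G'" if "(step UNIV)\<^sup>+\<^sup>+ G G'" for G'
      using that admissibleI(3) by (metis tranclpD)
    have "P G"
      by (rule assms(2)) (use admissibleI(1,2) later in \<open>auto intro: admissible.admissibleI\<close>)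
    with later show ?case by (metis rtranclpD)
  qed
  then show ?thesis by blast
qed

lemma steps_mono: "steps W G G' \<Longrightarrow> W \<subseteq> W' \<Longrightarrow> steps W' G G'"
proof (induction rule: rtranclp_induct)
  case (step G' G'')
  then have "step W' G' G''" unfolding step_def by blast
  with step show ?case by (meson rtranclp.rtrancl_into_rtrancl)
qed simp

lemma steps_antisym:
  assumes "admissible G" "steps W G E" "steps W E G"
  shows "E = G"
proof -
  \<comment> \<open>A cycle through \<open>G\<close> would make \<open>G\<close> an instance of its
    own induction hypothesis.\<close>
  have "\<not> (step UNIV)\<^sup>+\<^sup>+ G G"
    using assms(1)
  proof (induction rule: admissible_induct)
    case (step G)
    then show ?case by blast
  qed
  moreover have "(step UNIV)\<^sup>+\<^sup>+ G G" if "E \<noteq> G"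
  proof -
    have "steps UNIV G E" "steps UNIV E G" using assms steps_mono by blast+
    then have "(step UNIV)\<^sup>+\<^sup>+ G E" using that by (metis rtranclpD)
    then show ?thesis using \<open>steps UNIV E G\<close> by (rule tranclp_rtranclp_tranclp)
  qed
  ultimately show ?thesis by blast
qed

subsection \<open>Pivots and mirrored pivots\<close>

text \<open>In the original coordinates, \<open>k\<close> is the first bump to the right of
  \<open>(i, j)\<close> in row \<open>i\<close>, \<open>h\<close> is the last row above
  \<open>i\<close> with a bump in the columns \<open>{j..<k}\<close>, \<open>s\<close> is the last
  such column in row \<open>h\<close>, and \<open>r\<close> is the first row below \<open>h\<close>
  with a bump in column \<open>k\<close>. The move goes from \<open>(r, s)\<close> to
  \<open>(h, k)\<close>.\<close>

definition copivot :: "(int \<times> int) set \<Rightarrow> int \<Rightarrow> int \<Rightarrow> int \<Rightarrow> int \<Rightarrow> int \<Rightarrow> int \<Rightarrow> bool" where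
  "copivot G i j k s r h \<longleftrightarrow> pivot (mirror G) (- j) (- i) (- k) (- s) (- r) (- h)"

lemma copivotD:
  assumes "copivot G i j k s r h"
  shows "s < k" "j \<le> s" "r \<le> i" "h < r" "(i, k) \<notin> G" "(r, k) \<notin> G" "(h, s) \<notin> G"
  using pivotD[OF assms[unfolded copivot_def]] by auto

lemma copivot_full:
  assumes "copivot G i j k s r h" "h < x" "x \<le> i" "j \<le> y" "y < k"
  shows "(x, y) \<in> G"
  using pivot_full[OF assms(1)[unfolded copivot_def], of "- y" "- x"] assms by auto

lemma copivot_row:
  assumes "copivot G i j k s r h" "s < y" "y < k"
  shows "(h, y) \<in> G"
  using pivot_col[OF assms(1)[unfolded copivot_def], of "- y"] assms by auto

lemma copivot_col:
  assumes "copivot G i j k s r h" "h < x" "x < r"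
  shows "(x, k) \<in> G"
  using pivot_row[OF assms(1)[unfolded copivot_def], of "- x"] assms by auto

lemma copivot_ladder:
  assumes "copivot G i j k s r h" "no_double_crossing G"
  shows "ladder G r s h k"
  using ladder_mirror_imp[OF pivot_ladder[OF assms(1)[unfolded copivot_def] no_double_crossing_mirror[OF assms(2)]]]
  by simp

lemma copivot_mirror: "copivot (mirror G) (- j) (- i) (- h) (- r) (- b) (- k) \<longleftrightarrow> pivot G i j h r b k"
  unfolding copivot_def by simp

text \<open>Row \<open>i\<close> is full up to column \<open>k\<close>, so
  \<open>k \<le> k'\<close>. If \<open>k < k'\<close>, the bump \<open>(r, k)\<close> lies in the
  columns searched by the copivot, whence \<open>r \<le> h'\<close>; then \<open>(h', s)\<close>
  lies in the rows of the pivot block, whence \<open>k \<le> s\<close>. The two rectangles thus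
  share at most a corner.\<close>

lemma pivot_copivot:
  assumes p: "pivot G i j h r b k" and q: "copivot G i j k' s r' h'"
  shows "(r' = r \<and> s = b \<and> h' = h \<and> k' = k) \<or> (r \<le> h' \<and> k \<le> s \<and> k < k')"
proof -
  note dp = pivotD[OF p] and dq = copivotD[OF q]
  have kk: "k \<le> k'"
    using pivot_full[OF p, of i k'] dp dq by force
  show ?thesis
  proof (cases "k = k'")
    case True
    have "h \<le> h'" using copivot_full[OF q, of h b] dp dq True by force
    moreover have "h' \<le> h" using pivot_full[OF p, of h' s] dp dq True by force
    ultimately have h: "h' = h" by simp
    have "s = b"
    proof (cases s b rule: linorder_cases)
      case less
      then show ?thesis using copivot_row[OF q, of b] dp dq True h by force
    next
      case greater
      then show ?thesis using pivot_row[OF p, of s] dp dq True h by force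
    qed
    moreover have "r' = r"
    proof (cases r' r rule: linorder_cases)
      case less
      then show ?thesis using pivot_col[OF p, of r'] dp dq True h by force
    next
      case greater
      then show ?thesis using copivot_col[OF q, of r] dp dq True h by force
    qed
    ultimately show ?thesis using True h by simp
  next
    case False
    have rh: "r \<le> h'" using copivot_full[OF q, of r k] dp dq False kk by force
    have "k \<le> s" using pivot_full[OF p, of h' s] dp dq rh by force
    with rh False kk show ?thesis by simp
  qed
qed

lemma pivot_after_copivot:
  assumes p: "pivot G i j h r b k" and q: "copivot G i j k' s r' h'" and *: "r \<le> h'" "k \<le> s" "k < k'"
  shows "pivot (shift G r' s h' k') i j h r b k"
proof -
  note dp = pivotD[OF p] and dq = copivotD[OF q]
  show ?thesis
    unfolding pivot_def mem_shift
    using dp dq * pivot_full[OF p] pivot_col[OF p] pivot_row[OF p] by auto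
qed

lemma copivot_after_pivot:
  assumes p: "pivot G i j h r b k" and q: "copivot G i j k' s r' h'" and *: "r \<le> h'" "k \<le> s" "k < k'"
  shows "copivot (shift G r b h k) i j k' s r' h'"
proof -
  have "pivot (shift (mirror G) (- b) (- r) (- k) (- h)) (- j) (- i) (- k') (- s) (- r') (- h')"
    by (rule pivot_after_copivot[OF q[unfolded copivot_def] p[folded copivot_mirror]])
      (use * pivotD[OF p] in auto)
  then show ?thesis unfolding copivot_def mirror_shift .
qed

lemma moves_unblocked:
  assumes "moves i j G E"
  shows "unblocked G i j"
  using assms
proof (induction rule: moves.induct)
  case (moves_last G h k)
  then show ?case using pivotD[OF moves_last] pivot_full[OF moves_last, of i j]
    unfolding unblocked_def by blast
next
  case (moves_step G h r b k E)
  note d = pivotD[OF moves_step(1)]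
  obtain k' where k': "k' > j" "(i, k') \<notin> shift G r b h k"
    using moves_step.IH unfolding unblocked_def by blast
  have "\<exists>k'>j. (i, k') \<notin> G"
  proof (cases "(i, k') \<in> G")
    case True
    then have "i = r" using k'(2) by (auto simp: mem_shift)
    then show ?thesis using d by (intro exI[of _ k]) auto
  qed (use k' in blast)
  moreover have "(i, j) \<in> G" using pivot_full[OF moves_step(1), of i j] d by auto
  moreover have "h < i" using d by auto
  ultimately show ?case using d unfolding unblocked_def by blast
qed

lemma unblocked_copivot:
  assumes "unblocked G i j"
  shows "\<exists>k s r h. copivot G i j k s r h"
proof -
  obtain a b c d where "pivot (mirror G) (- j) (- i) a b c d"
    using unblocked_pivot[OF unblocked_mirror[OF assms]] by blast
  then have "copivot G i j (- a) (- b) (- c) (- d)" unfolding copivot_def by simp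
  then show ?thesis by blast
qed

lemma shift_commute:
  assumes "(x, y) \<noteq> (h, k)" "(i, j) \<noteq> (g, z)"
  shows "shift (shift G i j h k) x y g z = shift (shift G x y g z) i j h k"
  using assms unfolding shift_def by auto

text \<open>If the two pivots differ, the pivot move is made first, the induction hypothesis takes
  the copivot move after it, and the two moves are exchanged.\<close>

lemma moves_copivot_step:
  assumes "admissible G" "moves i j G E" "copivot G i j k s r h"
  shows "if (r, s) = (i, j) then E = shift G i j h k else moves i j (shift G r s h k) E"
  using assms
proof (induction rule: admissible.induct)
  case (admissibleI G)
  obtain h' r' b k' where p: "pivot G i j h' r' b k'" using unblocked_pivot[OF moves_unblocked] admissibleI by blast
  note q = admissibleI.prems(2)
  note st = moves_pivot_step[OF admissibleI.prems(1) p]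
  show ?case
  proof (cases "r = r' \<and> s = b \<and> h = h' \<and> k = k'")
    case True
    then show ?thesis using st by simp
  next
    case False
    then have *: "r' \<le> h" "k' \<le> s" "k' < k" using pivot_copivot[OF p q] by auto
    note dp = pivotD[OF p] and dq = copivotD[OF q]
    have n1: "(r', b) \<noteq> (i, j)" and n2: "(r, s) \<noteq> (i, j)" using * dp dq by auto
    have m: "moves i j (shift G r' b h' k') E" using st n1 by simp
    have l: "ladder G r' b h' k'" using pivot_ladder[OF p] admissibleI(1) by blast
    then have "step UNIV G (shift G r' b h' k')" unfolding step_def by blast
    then have "moves i j (shift (shift G r' b h' k') r s h k) E"
      using admissibleI.IH m copivot_after_pivot[OF p q *] n2 by auto
    moreover have "shift (shift G r' b h' k') r s h k = shift (shift G r s h k) r' b h' k'"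
      by (rule shift_commute) (use * dp dq in auto)
    ultimately have "moves i j (shift G r s h k) E"
      using moves_step[OF pivot_after_copivot[OF p q *] n1] by simp
    then show ?thesis using n2 by auto
  qed
qed

text \<open>Copivot steps of a grid, read in its reflection, are pivot steps.\<close>

lemma moves_mirror:
  assumes "admissible G" "moves i j G E"
  shows "moves (- j) (- i) (mirror G) (mirror E)"
  using assms
proof (induction rule: admissible.induct)
  case (admissibleI G)
  have adm: "admissible G" using admissibleI admissible.admissibleI by blast
  obtain k s r h where q: "copivot G i j k s r h" using unblocked_copivot[OF moves_unblocked] admissibleI by blast
  note st = moves_copivot_step[OF adm admissibleI.prems q]
  note q' = q[unfolded copivot_def]
  show ?case
  proof (cases "(r, s) = (i, j)")
    case True
    then show ?thesis using st moves_last[of "mirror G" "- j" "- i" "- k" "- h"] q' by (simp add: mirror_shift)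
  next
    case False
    have "step UNIV G (shift G r s h k)"
      unfolding step_def using copivot_ladder[OF q admissibleI(1)] by blast
    then have "moves (- j) (- i) (mirror (shift G r s h k)) (mirror E)" using admissibleI.IH st False by auto
    then show ?thesis using moves_step[OF q'] False unfolding mirror_shift by auto
  qed
qed

subsection \<open>Monotonicity\<close>

definition monotone_moves :: "(int \<times> int) set \<Rightarrow> int \<Rightarrow> int \<Rightarrow> (int \<times> int) set \<Rightarrow> bool" where
  "monotone_moves W i j G \<longleftrightarrow> (\<forall>x y g z E E'. ladder G x y g z \<longrightarrow> x < i \<or> j < y \<longrightarrow> (x, y) \<in> W \<longrightarrow>
     moves i j G E \<longrightarrow> moves i j (shift G x y g z) E' \<longrightarrow> steps W E E')"

definition northeast_closed :: "(int \<times> int) set \<Rightarrow> bool" where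
  "northeast_closed W \<longleftrightarrow> (\<forall>x y x' y'. (x, y) \<in> W \<longrightarrow> x' \<le> x \<longrightarrow> y \<le> y' \<longrightarrow> (x', y') \<in> W)"

lemma northeast_closed_mirror: "northeast_closed W \<Longrightarrow> northeast_closed (mirror W)"
  unfolding northeast_closed_def by auto

lemma monotone_movesD:
  assumes "monotone_moves W i j G" "ladder G x y g z" "x < i \<or> j < y" "(x, y) \<in> W"
    "moves i j G E" "moves i j (shift G x y g z) E'"
  shows "steps W E E'"
  using assms unfolding monotone_moves_def by blast

lemma monotone_moves_mirror:
  assumes mono: "monotone_moves W i j G" and adm: "admissible G"
  shows "monotone_moves (mirror W) (- j) (- i) (mirror G)"
  unfolding monotone_moves_def
proof (intro allI impI)
  fix x y g z E E'
  assume l: "ladder (mirror G) x y g z" and xy: "x < - j \<or> - i < y" "(x, y) \<in> mirror W"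
    and m: "moves (- j) (- i) (mirror G) E" "moves (- j) (- i) (shift (mirror G) x y g z) E'"
  have l': "ladder G (- y) (- x) (- z) (- g)" using ladder_mirror_imp[OF l] by simp
  have "moves i j G (mirror E)"
    using moves_mirror[OF admissible_mirror[OF adm] m(1)] by simp
  moreover have "shift (mirror G) x y g z = mirror (shift G (- y) (- x) (- z) (- g))" by (simp add: mirror_shift)
  then have "moves i j (shift G (- y) (- x) (- z) (- g)) (mirror E')"
    using moves_mirror[OF admissible_mirror[OF admissible_cases(2)[OF adm l']]] m(2) by fastforce
  ultimately have "steps W (mirror E) (mirror E')"
    by (rule monotone_movesD[OF mono l', rotated 2]) (use xy in auto)
  then show "steps (mirror W) E E'" using steps_mirror_imp by fastforce
qed

lemma step_imp_steps: "step W G G' \<Longrightarrow> steps W G G'"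
  by (rule r_into_rtranclp)

text \<open>The move opens \<open>(h, y)\<close> in the row used by the pivot, so \<open>y\<close>
  replaces \<open>b\<close>: the shifted grid moves \<open>(r, y)\<close> to \<open>(h, k)\<close>
  and then \<open>(r, b)\<close> to \<open>(h, y)\<close>. The same grid arises from the pivot move
  on \<open>G\<close> followed by the ladder move from \<open>(r, y)\<close> to
  \<open>(g, k)\<close>; the extra move survives with another starting cross.\<close>

lemma steps_pivot_lower_right:
  assumes p: "pivot G i j h r b k" and l: "ladder G h y g k" and "b < y"
    and adm: "admissible G" and W: "northeast_closed W" "(i, j) \<in> W"
    and IH: "\<And>G'. (step UNIV)\<^sup>+\<^sup>+ G G' \<Longrightarrow> monotone_moves W i j G'"
    and m: "moves i j G E" "moves i j (shift G h y g k) E'"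
  shows "steps W E E'"
proof -
  note dp = pivotD[OF p] and dl = ladderD[OF l]
  have lp: "ladder G r b h k" using pivot_ladder[OF p admissible_cases(1)[OF adm]] .
  define G1 where "G1 = shift (shift G h y g k) r y h k"
  define G2 where "G2 = shift G1 r b h y"
  define Gc where "Gc = shift G r b h k"
  have p1: "pivot (shift G h y g k) i j h r y k"
    unfolding pivot_def mem_shift using dp dl \<open>b < y\<close> pivot_full[OF p] pivot_col[OF p] pivot_row[OF p] by auto
  have m1: "moves i j G1 E'"
    using moves_pivot_step[OF m(2) p1] dp \<open>b < y\<close> unfolding G1_def by auto
  have p2: "pivot G1 i j h r b y"
    unfolding pivot_def G1_def mem_shift using dp dl \<open>b < y\<close> pivot_full[OF p] pivot_row[OF p] by auto
  have l2: "ladder Gc r y g k"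
    unfolding ladder_def
  proof (intro conjI allI impI)
    fix u v assume u: "g \<le> u" "u \<le> r" "y \<le> v" "v \<le> k" "(u, v) \<notin> {(g, y), (r, k), (g, k)}"
    show "(u, v) \<in> Gc"
    proof (cases "u \<le> h")
      case True
      then show ?thesis using ladder_hole[OF l, of u v] u \<open>b < y\<close> dp dl unfolding Gc_def mem_shift by auto
    next
      case False
      then show ?thesis using pivot_full[OF p, of u v] pivot_col[OF p, of u] u \<open>b < y\<close> dp dl
        unfolding Gc_def mem_shift by (cases "v = k") auto
    qed
  qed (use dp dl \<open>b < y\<close> pivot_full[OF p, of r y] in \<open>auto simp: Gc_def mem_shift\<close>)
  have eq: "shift Gc r y g k = G2"
    unfolding G2_def G1_def Gc_def using dp dl \<open>b < y\<close> pivot_full[OF p, of r y] pivot_full[OF p, of r b]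
    by (auto simp: shift_def)
  have yW: "(r, y) \<in> W" using W dp \<open>b < y\<close> unfolding northeast_closed_def by (meson less_imp_le order_trans)
  show ?thesis
  proof (cases "(r, b) = (i, j)")
    case True
    have "E = Gc" using moves_pivot_step[OF m(1) p] True by (simp add: Gc_def)
    moreover have "E' = G2" using moves_pivot_step[OF m1 p2] True by (simp add: G2_def)
    ultimately have "step W E E'" unfolding step_def using l2 eq yW by blast
    then show ?thesis by (rule step_imp_steps)
  next
    case False
    have "moves i j Gc E" using moves_pivot_step[OF m(1) p] False by (simp add: Gc_def if_False split: if_splits)
    moreover have "moves i j (shift Gc r y g k) E'"
      unfolding eq using moves_pivot_step[OF m1 p2] False by (simp add: G2_def split: if_splits)
    moreover have "step UNIV G Gc" unfolding step_def Gc_def using lp by blast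
    then have "monotone_moves W i j Gc" using IH by blast
    ultimately show ?thesis
      by (rule monotone_movesD[OF _ l2, rotated 3]) (use yW dp \<open>b < y\<close> in auto)
  qed
qed

text \<open>The move fills \<open>(h, b)\<close>, so the pivot of the shifted grid moves
  \<open>(r, y)\<close> to \<open>(h, k)\<close>. On the side of \<open>G\<close> this takes two
  pivot moves, \<open>(r, b)\<close> to \<open>(h, k)\<close> and \<open>(r, y)\<close> to
  \<open>(h, b)\<close>; the extra move then goes from \<open>(x, y)\<close> only as far as
  \<open>(r, b)\<close>.\<close>

lemma steps_pivot_upper_left:
  assumes p: "pivot G i j h r b k" and l: "ladder G x y h b" and xy: "i < x" "j < y"
    and adm: "admissible G" and W: "(x, y) \<in> W"
    and IH: "\<And>G'. (step UNIV)\<^sup>+\<^sup>+ G G' \<Longrightarrow> monotone_moves W i j G'"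
    and m: "moves i j G E" "moves i j (shift G x y h b) E'"
  shows "steps W E E'"
proof -
  note dp = pivotD[OF p] and dl = ladderD[OF l]
  have lp: "ladder G r b h k" using pivot_ladder[OF p admissible_cases(1)[OF adm]] .
  define Gc where "Gc = shift G r b h k"
  define G2 where "G2 = shift Gc r y h b"
  define G1 where "G1 = shift (shift G x y h b) r y h k"
  have row: "(h, v) \<in> G" if "y < v" "v < b" for v
    using ladder_hole[OF l, of h v] that dl by auto
  have p1: "pivot (shift G x y h b) i j h r y k"
    unfolding pivot_def mem_shift using dp dl xy row pivot_full[OF p] pivot_col[OF p] pivot_row[OF p] by force
  have m1: "moves i j G1 E'"
    using moves_pivot_step[OF m(2) p1] xy unfolding G1_def by auto
  have pc: "pivot Gc i j h r y b"
    unfolding pivot_def Gc_def mem_shift using dp dl xy row pivot_full[OF p] by auto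
  have mc: "moves i j Gc E"
    using moves_pivot_step[OF m(1) p] xy dl unfolding Gc_def by auto
  have m2: "moves i j G2 E"
    using moves_pivot_step[OF mc pc] xy unfolding G2_def by auto
  have admc: "admissible Gc" unfolding Gc_def using admissible_cases(2)[OF adm lp] .
  have lc: "ladder Gc r y h b" using pivot_ladder[OF pc admissible_cases(1)[OF admc]] .
  have l2: "ladder G2 x y r b"
    unfolding ladder_def
  proof (intro conjI allI impI)
    fix u v assume u: "r \<le> u" "u \<le> x" "y \<le> v" "v \<le> b" "(u, v) \<notin> {(r, y), (x, b), (r, b)}"
    show "(u, v) \<in> G2"
      using ladder_hole[OF l, of u v] u xy dp dl unfolding G2_def Gc_def mem_shift by auto
  qed (use dp dl xy in \<open>auto simp: G2_def Gc_def mem_shift\<close>)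
  have eq: "shift G2 x y r b = G1"
    unfolding G2_def G1_def Gc_def using dp dl xy pivot_full[OF p, of r y] pivot_full[OF p, of r b]
    by (auto simp: shift_def)
  have "step UNIV G Gc" "step UNIV Gc G2" unfolding step_def Gc_def G2_def using lp lc[unfolded Gc_def] by blast+
  then have "(step UNIV)\<^sup>+\<^sup>+ G G2" by (meson tranclp.intros)
  then have "monotone_moves W i j G2" by (rule IH)
  then show ?thesis
    by (rule monotone_movesD[OF _ l2 _ W m2]) (use xy m1 eq in auto)
qed

text \<open>A ladder that starts in the full block has to reach row \<open>h\<close> and column
  \<open>k\<close>, so \<open>(h, k)\<close> lies in its rectangle, and so does
  \<open>(r, k)\<close> if it starts at or below row \<open>r\<close>. Since a ladder has bumps only
  at three corners, this leaves only the pivot move itself.\<close>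

lemma pivot_avoid:
  assumes p: "pivot G i j h r b k" and hk: "(h, k) \<notin> G" and l: "ladder G x y g z" and xy: "x < i \<or> j < y"
    and ne: "(x, y) \<noteq> (r, b)" and N1: "\<not> (g = h \<and> y = k)"
  shows "\<not> (g = h \<and> z = j)"
    and "\<not> (h < x \<and> x \<le> i \<and> j \<le> y \<and> y < k)"
    and "\<not> (h < x \<and> x < r \<and> y = k)"
proof -
  note dp = pivotD[OF p] and dl = ladderD[OF l]
  show "\<not> (g = h \<and> z = j)"
    using pivot_full[OF p, of x j] xy dl dp by force
  show "\<not> (h < x \<and> x \<le> i \<and> j \<le> y \<and> y < k)"
  proof
    assume *: "h < x \<and> x \<le> i \<and> j \<le> y \<and> y < k"
    have zk: "k \<le> z" using pivot_full[OF p, of x z] * dl by force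
    have gh: "g \<le> h" using pivot_full[OF p, of g y] * dl by force
    show False
    proof (cases x r rule: linorder_cases)
      case less
      then have "z \<noteq> k" using pivot_col[OF p, of x] * dl by auto
      then show False using ladder_hole[OF l hk] * zk gh by auto
    next
      case greater
      then show False using ladder_hole[OF l dp(7)] * zk gh dp by auto
    next
      case equal
      then have z: "z = k" using ladder_hole[OF l dp(7)] * zk gh dp by auto
      then have g: "g = h" using ladder_hole[OF l hk] * gh by auto
      show False
      proof (cases "b < y")
        case True
        then show False using pivot_row[OF p True] * g dl by auto
      next
        case False
        then show False using ladder_hole[OF l dp(6)] * g z equal ne dp by auto
      qed
    qed
  qed
  show "\<not> (h < x \<and> x < r \<and> y = k)"
  proof
    assume *: "h < x \<and> x < r \<and> y = k"
    have "g \<le> h" using pivot_col[OF p, of g] * dl by force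
    then show False using ladder_hole[OF l hk] * N1 dl by auto
  qed
qed

lemma pivot_kept:
  assumes p: "pivot G i j h r b k" and hk: "(h, k) \<notin> G" and l: "ladder G x y g z" and xy: "x < i \<or> j < y"
    and ne: "(x, y) \<noteq> (r, b)" and N1: "\<not> (g = h \<and> y = k)" and N2: "\<not> (x = h \<and> b < y \<and> z = k)"
    and N3: "\<not> (g = h \<and> z = b)" and N4: "\<not> (g = r \<and> z = k)"
  shows "pivot (shift G x y g z) i j h r b k"
proof -
  note dp = pivotD[OF p] and dl = ladderD[OF l]
  note av = pivot_avoid[OF p hk l xy ne N1]
  have "\<not> (x = h \<and> b < y \<and> y < k)"
  proof
    assume *: "x = h \<and> b < y \<and> y < k"
    have "\<not> k < z" using ladder_hole[OF l hk] * dl by auto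
    moreover have "\<not> z < k" using pivot_row[OF p, of z] * dl by auto
    ultimately show False using N2 * by auto
  qed
  with av show ?thesis
    unfolding pivot_def mem_shift
    using dp dl N3 N4 pivot_full[OF p] pivot_col[OF p] pivot_row[OF p] by auto
qed

text \<open>The pivot move opens \<open>(r, b)\<close> and fills \<open>(h, k)\<close>. Hence
  \<open>(r, b)\<close> must lie outside the rectangle of the ladder, and \<open>(h, k)\<close> must
  be none of its three bumps.\<close>

lemma ladder_kept:
  assumes p: "pivot G i j h r b k" and hk: "(h, k) \<notin> G" and l: "ladder G x y g z" and xy: "x < i \<or> j < y"
    and ne: "(x, y) \<noteq> (r, b)" and N1: "\<not> (g = h \<and> y = k)" and N2: "\<not> (x = h \<and> b < y \<and> z = k)"
    and N3: "\<not> (g = h \<and> z = b)" and N4: "\<not> (g = r \<and> z = k)"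
  shows "ladder (shift G r b h k) x y g z"
proof -
  note dp = pivotD[OF p] and dl = ladderD[OF l]
  note av = pivot_avoid[OF p hk l xy ne N1]
  have rb: "\<not> (g \<le> r \<and> r \<le> x \<and> y \<le> b \<and> b \<le> z)"
  proof
    assume *: "g \<le> r \<and> r \<le> x \<and> y \<le> b \<and> b \<le> z"
    show False
    proof (cases "k \<le> z")
      case True
      then have e: "x = r" "z = k" using ladder_hole[OF l dp(7)] * dp N4 by auto
      then have "y < b" using * ne by auto
      show False
      proof (cases "g \<le> h")
        case True
        then show False using ladder_hole[OF l dp(6)] * e \<open>y < b\<close> dp by auto
      next
        case False
        then have "j \<le> y \<Longrightarrow> False" using pivot_full[OF p, of g y] e dl dp \<open>y < b\<close> by auto
        moreover have "(g, k) \<in> G" using pivot_col[OF p, of g] False e dl by auto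
        ultimately show False using e dl by auto
      qed
    next
      case False
      have "i < x" using pivot_full[OF p, of x z] False * dl dp by force
      then have "j < y" using xy by auto
      have gh: "g \<le> h" using pivot_full[OF p, of g z] False * dl dp by force
      then have "g = h" "y = b" using ladder_hole[OF l dp(6)] * dp N3 by auto
      then show False using pivot_row[OF p, of z] False dl by auto
    qed
  qed
  have "\<not> (x = h \<and> z = k)"
  proof
    assume *: "x = h \<and> z = k"
    then have "y < b" using N2 dl ne pivotD[OF p] l by (cases y b rule: linorder_cases) auto
    then show False using ladder_hole[OF l dp(6)] * dp dl by auto
  qed
  moreover have "\<not> (g = h \<and> z = k)"
  proof
    assume *: "g = h \<and> z = k"
    have "\<not> r < x" using ladder_hole[OF l dp(7)] * dp dl by auto
    moreover have "\<not> x < r" using pivot_col[OF p, of x] * dl by auto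
    ultimately have "x = r" by simp
    have "\<not> y \<le> b" using rb * \<open>x = r\<close> dp by auto
    then show False using pivot_row[OF p, of y] * dl by auto
  qed
  ultimately show ?thesis
    using l rb N1 ne dl unfolding ladder_def mem_shift by auto
qed

text \<open>The configurations excluded by \<open>N1\<close> and \<open>N4\<close> are the
  reflections of the cases \<open>N2\<close> and \<open>N3\<close> treated here.\<close>

lemma steps_pivot:
  assumes p: "pivot G i j h r b k" and l: "ladder G x y g z" and xy: "x < i \<or> j < y"
    and N1: "\<not> (g = h \<and> y = k)" and N4: "\<not> (g = r \<and> z = k)"
    and adm: "admissible G" and W: "northeast_closed W" "(i, j) \<in> W" "(x, y) \<in> W"
    and IH: "\<And>G'. (step UNIV)\<^sup>+\<^sup>+ G G' \<Longrightarrow> monotone_moves W i j G'"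
    and m: "moves i j G E" "moves i j (shift G x y g z) E'"
  shows "steps W E E'"
proof -
  note dp = pivotD[OF p] and dl = ladderD[OF l]
  have lp: "ladder G r b h k" using pivot_ladder[OF p admissible_cases(1)[OF adm]] .
  note hk = ladderD(6)[OF lp]
  consider (same) "(x, y) = (r, b)" | (N2) "x = h \<and> b < y \<and> z = k" | (N3) "g = h \<and> z = b" |
    (commute) "(x, y) \<noteq> (r, b)" "\<not> (x = h \<and> b < y \<and> z = k)" "\<not> (g = h \<and> z = b)" by blast
  then show ?thesis
  proof cases
    case same
    \<comment> \<open>The given move is the first move of the evaluation itself, so both evaluations
      end in the same grid.\<close>
    then have e: "shift G x y g z = shift G r b h k" using ladder_unique[OF lp] l by auto
    have "(r, b) \<noteq> (i, j)" using same xy by auto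
    then have "moves i j (shift G x y g z) E" using moves_pivot_step[OF m(1) p] e by auto
    then show ?thesis using moves_unique[OF _ m(2)] by auto
  next
    case N2
    show ?thesis
      by (rule steps_pivot_lower_right[OF p _ _ adm W(1,2) IH m(1)]) (use N2 l m(2) in auto)
  next
    case N3
    have "j < b" using pivot_avoid(1)[OF p hk l xy _ N1] N3 dp dl by (cases "b = j") auto
    have rx: "\<not> h < x \<or> \<not> x \<le> i" using pivot_full[OF p, of x b] N3 dl dp by auto
    then have "i < x" using dl N3 by auto
    moreover from this have "j < y" using xy by auto
    ultimately show ?thesis
      using steps_pivot_upper_left[OF p _ _ _ adm W(3) IH m(1)] N3 l m(2) by auto
  next
    case commute
    note pk = pivot_kept[OF p hk l xy commute(1) N1 commute(2,3) N4]
    note lk = ladder_kept[OF p hk l xy commute(1) N1 commute(2,3) N4]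
    have eq: "shift (shift G x y g z) r b h k = shift (shift G r b h k) x y g z"
      by (rule shift_commute) (use lp hk dl ladderD[OF lp] in auto)
    show ?thesis
    proof (cases "(r, b) = (i, j)")
      case True
      then have "E = shift G r b h k" "E' = shift (shift G r b h k) x y g z"
        using moves_pivot_step[OF m(1) p] moves_pivot_step[OF m(2) pk] eq by auto
      then have "step W E E'" using lk W(3) unfolding step_def by blast
      then show ?thesis by (rule step_imp_steps)
    next
      case False
      have mc: "moves i j (shift G r b h k) E" "moves i j (shift (shift G r b h k) x y g z) E'"
        using moves_pivot_step[OF m(1) p] moves_pivot_step[OF m(2) pk] False unfolding eq by auto
      have "step UNIV G (shift G r b h k)" unfolding step_def using lp by blast
      then have "monotone_moves W i j (shift G r b h k)" using IH by blast
      then show ?thesis by (rule monotone_movesD[OF _ lk xy W(3) mc])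
    qed
  qed
qed

lemma moves_monotone:
  assumes "admissible G" and W: "northeast_closed W" "(i, j) \<in> W"
  shows "monotone_moves W i j G"
  using assms(1)
proof (induction rule: admissible_induct)
  case (step G)
  note adm = step(1) and IH = step(2)
  show ?case
    unfolding monotone_moves_def
  proof (intro allI impI)
    fix x y g z E E'
    assume l: "ladder G x y g z" and xy: "x < i \<or> j < y" and xyW: "(x, y) \<in> W"
      and m: "moves i j G E" "moves i j (shift G x y g z) E'"
    obtain h r b k where p: "pivot G i j h r b k" using unblocked_pivot[OF moves_unblocked[OF m(1)]] by blast
    note dp = pivotD[OF p] and dl = ladderD[OF l]
    show "steps W E E'"
    proof (cases "(g = h \<and> y = k) \<or> (g = r \<and> z = k)")
      case False
      then show ?thesis using steps_pivot[OF p l xy _ _ adm W xyW IH m] by blast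
    next
      case True
      obtain k' s r' h' where q: "copivot G i j k' s r' h'" using unblocked_copivot[OF moves_unblocked[OF m(1)]] by blast
      note dq = copivotD[OF q] and pq = pivot_copivot[OF p q]
      \<comment> \<open>\<open>N2\<close> and \<open>N3\<close> say that the copivot avoids the
        reflections of the two configurations just met; by \<open>pq\<close> it is the pivot itself
        or lies southeast of it.\<close>
      have N2: "\<not> (x = h' \<and> z = k')"
        using True pq ladder_hole[OF l dp(7)] dl dp by auto
      have N3: "\<not> (g = h' \<and> z = s)"
      proof
        assume *: "g = h' \<and> z = s"
        then have e: "g = r" "z = k" "r \<le> h'" "k \<le> s" "k < k'" using True pq dl dp by auto
        have "i < x" using copivot_full[OF q, of x s] * dl dq by force
        then show False using pivot_full[OF p, of g y] e xy dl dp by auto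
      qed
      have "steps (mirror W) (mirror E) (mirror E')"
      proof (rule steps_pivot[OF q[unfolded copivot_def] ladder_mirror_imp[OF l]])
        show "- y < - j \<or> - i < - x" using xy by auto
        show "\<not> (- z = - k' \<and> - x = - h')" using N2 by auto
        show "\<not> (- z = - s \<and> - g = - h')" using N3 by auto
        show "admissible (mirror G)" using admissible_mirror[OF adm] .
        show "northeast_closed (mirror W)" using northeast_closed_mirror[OF W(1)] .
        show "(- j, - i) \<in> mirror W" "(- y, - x) \<in> mirror W" using W(2) xyW by auto
        show "moves (- j) (- i) (mirror G) (mirror E)" using moves_mirror[OF adm m(1)] .
        show "moves (- j) (- i) (shift (mirror G) (- y) (- x) (- z) (- g)) (mirror E')"
          using moves_mirror[OF admissible_cases(2)[OF adm l] m(2)] unfolding mirror_shift .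
        \<comment> \<open>Grids reachable from \<open>mirror G\<close> are reflections of grids
          reachable from \<open>G\<close>, so the induction hypothesis transfers.\<close>
        fix G' assume "(step UNIV)\<^sup>+\<^sup>+ (mirror G) G'"
        then have "(step UNIV)\<^sup>+\<^sup>+ G (mirror G') \<and> admissible (mirror G')"
        proof (induction rule: tranclp_induct)
          case (base G')
          have "step UNIV G (mirror G')" using step_mirror_imp[OF base] by (auto simp: mirror_def step_def)
          then show ?case using adm by (blast elim: admissible.cases)
        next
          case (step G' G'')
          have "step UNIV (mirror G') (mirror G'')" using step_mirror_imp[OF step(2)] by (auto simp: mirror_def step_def)
          then show ?case using step by (meson admissible.cases tranclp.trancl_into_trancl)
        qed
        then show "monotone_moves (mirror W) (- j) (- i) G'"
          using monotone_moves_mirror[OF IH, of "mirror G'"] by auto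
      qed
      then show ?thesis using steps_mirror_imp by fastforce
    qed
  qed
qed

subsection \<open>Leastness and commutation\<close>

text \<open>Induction on the path from its first move. A first move at \<open>(i, j)\<close> is
  already the whole evaluation. Any other starts, by minimality, at a cross not weakly southwest of
  \<open>(i, j)\<close>, and monotonicity compares the results before and after it.\<close>

lemma moves_least:
  assumes "steps W G E" and "admissible G" and "(i, j) \<in> G" "(i, j) \<notin> E"
    and W: "northeast_closed W" "(i, j) \<in> W"
    and minimal: "\<And>x y. (x, y) \<in> W \<Longrightarrow> i \<le> x \<Longrightarrow> y \<le> j \<Longrightarrow> (x, y) = (i, j)"
  shows "\<exists>E0. moves i j G E0 \<and> steps W E0 E"
  using assms(1-3)
proof (induction rule: converse_rtranclp_induct)
  case base
  then show ?case using assms(4) by blast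
next
  case (step G G1)
  obtain x y g z where xyW: "(x, y) \<in> W" and l: "ladder G x y g z" and G1: "G1 = shift G x y g z"
    using step(1) unfolding step_def by blast
  note dl = ladderD[OF l]
  show ?case
  proof (cases "(x, y) = (i, j)")
    case True
    then have "moves i j G G1" using moves_last[OF ladder_pivot] l G1 by blast
    with step(2) show ?thesis by blast
  next
    case False
    then have "(i, j) \<in> G1" using step.prems G1 by (auto simp: mem_shift)
    moreover have "admissible G1" using admissible_cases(2)[OF step.prems(1) l] G1 by simp
    ultimately obtain E1 where m1: "moves i j G1 E1" "steps W E1 E" using step.IH by blast
    have fr1: "unblocked G1 i j" using moves_unblocked m1 by blast
    \<comment> \<open>A bump of \<open>G1\<close> that is a cross of \<open>G\<close> is the vacated
      position \<open>(x, y)\<close>; then \<open>(g, y)\<close> above it is a bump of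
      \<open>G\<close>, and likewise \<open>(x, z)\<close> to its right.\<close>
    have "\<exists>h<i. (h, j) \<notin> G"
    proof -
      obtain h where "h < i" "(h, j) \<notin> G1" using fr1 unfolding unblocked_def by blast
      then show ?thesis using dl unfolding G1 mem_shift by (metis less_trans)
    qed
    moreover have "\<exists>k>j. (i, k) \<notin> G"
    proof -
      obtain k where "k > j" "(i, k) \<notin> G1" using fr1 unfolding unblocked_def by blast
      then show ?thesis using dl unfolding G1 mem_shift by (metis less_trans)
    qed
    ultimately have "unblocked G i j" using step.prems unfolding unblocked_def by blast
    then obtain E0 where m0: "moves i j G E0" using moves_exists step.prems by blast
    have "x < i \<or> j < y" using minimal[OF xyW] False by force
    then have "steps W E0 E1"
      using monotone_movesD[OF moves_monotone[OF step.prems(1) W] l _ xyW m0] m1 G1 by blast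
    with m0 m1 show ?thesis by (meson rtranclp_trans)
  qed
qed

lemma steps_unblocked:
  assumes "steps W G E" "unblocked G i j" "\<And>x y. (x, y) \<in> W \<Longrightarrow> x < i \<or> j < y"
  shows "unblocked E i j"
  using assms(1,2)
proof (induction rule: rtranclp_induct)
  case (step G' G'')
  then show ?case using unblocked_shift assms(3) unfolding step_def by blast
qed

text \<open>A cross arriving at \<open>(i, j)\<close> would start strictly southwest of it.\<close>

lemma steps_notin:
  assumes "steps W G E" "(i, j) \<notin> G" "\<And>x y. (x, y) \<in> W \<Longrightarrow> x \<le> i \<or> j \<le> y"
  shows "(i, j) \<notin> E"
  using assms(1,2)
proof (induction rule: rtranclp_induct)
  case (step G' G'')
  then obtain x y g z where "(x, y) \<in> W" "ladder G' x y g z" "G'' = shift G' x y g z"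
    unfolding step_def by blast
  then show ?case using assms(3)[of x y] step ladderD[of G' x y g z] by (auto simp: mem_shift)
qed

lemma moves_commute:
  assumes adm: "admissible G" and A: "moves i j G A" and B: "moves p q G B" and "i < p" "j < q"
  shows "\<exists>E. moves p q A E \<and> moves i j B E"
proof -
  let ?Wi = "{..i} \<times> {j..}" and ?Wp = "{..p} \<times> {q..}"
  let ?W = "?Wi \<union> ?Wp"
  have W: "northeast_closed ?W" unfolding northeast_closed_def by auto
  have mi: "(x, y) = (i, j)" if "(x, y) \<in> ?W" "i \<le> x" "y \<le> j" for x y using that \<open>j < q\<close> by auto
  have mp: "(x, y) = (p, q)" if "(x, y) \<in> ?W" "p \<le> x" "y \<le> q" for x y using that \<open>i < p\<close> by auto
  note pA = moves_props[OF A adm] and pB = moves_props[OF B adm]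
  have "unblocked A p q" by (rule steps_unblocked[OF pA(3) moves_unblocked[OF B]]) (use \<open>i < p\<close> in auto)
  then obtain E where E: "moves p q A E" using moves_exists pA(1) by blast
  have "unblocked B i j" by (rule steps_unblocked[OF pB(3) moves_unblocked[OF A]]) (use \<open>j < q\<close> in auto)
  then obtain F where F: "moves i j B F" using moves_exists pB(1) by blast
  note pE = moves_props[OF E pA(1)] and pF = moves_props[OF F pB(1)]
  have iE: "(i, j) \<notin> E" by (rule steps_notin[OF pE(3) pA(2)]) (use \<open>j < q\<close> in auto)
  have pF': "(p, q) \<notin> F" by (rule steps_notin[OF pF(3) pB(2)]) (use \<open>i < p\<close> in auto)
  have GE: "steps ?W G E" using steps_mono[OF pA(3), of ?W] steps_mono[OF pE(3), of ?W] by auto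
  have GF: "steps ?W G F" using steps_mono[OF pB(3), of ?W] steps_mono[OF pF(3), of ?W] by auto
  \<comment> \<open>Leastness of \<open>B\<close> at \<open>(p, q)\<close> puts it below
    \<open>E\<close>. The path from \<open>B\<close> to \<open>E\<close> still moves
    \<open>(i, j)\<close>, so leastness of \<open>F\<close> at \<open>(i, j)\<close>, starting from
    \<open>B\<close>, puts \<open>F\<close> below \<open>E\<close>.\<close>
  have "steps ?W B E"
    using moves_least[OF GE adm pB(4) pE(2) W _ mp] moves_unique[OF B] by auto
  then have FE: "steps ?W F E"
    using moves_least[OF _ pB(1) pF(4) iE W _ mi] moves_unique[OF F] by fastforce
  have "steps ?W A F"
    using moves_least[OF GF adm pA(4) pF(2) W _ mi] moves_unique[OF A] by auto
  then have "steps ?W E F"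
    using moves_least[OF _ pA(1) pE(4) pF' W _ mp] moves_unique[OF E] by fastforce
  then have "E = F" using steps_antisym[OF pF(1) FE] by simp
  with E F show ?thesis by blast
qed

subsection \<open>Unrolling the recursion into pivot moves\<close>

text \<open>The block below row \<open>a\<close> is full up to a bump of row \<open>a\<close>, and a
  pivot for \<open>(a, j)\<close> does not pass that bump. It is therefore also a pivot for
  \<open>(i, j)\<close>, so the evaluation at \<open>(a, j)\<close> is an initial segment of the one
  at \<open>(i, j)\<close>.\<close>

lemma moves_via_row:
  assumes "moves a j G A" "moves i j A E" "a < i" "j < k" "(a, k) \<notin> G"
    "\<And>x y. a \<le> x \<Longrightarrow> x \<le> i \<Longrightarrow> j \<le> y \<Longrightarrow> y < k \<Longrightarrow> (x, y) \<in> G"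
  shows "moves i j G E"
  using assms
proof (induction arbitrary: k rule: moves.induct)
  case (moves_last G h c)
  note d = pivotD[OF moves_last(1)]
  have "c \<le> k" using pivot_full[OF moves_last(1), of a k] moves_last d by force
  then have "pivot G i j h a j c"
    unfolding pivot_def using d moves_last pivot_full[OF moves_last(1)] pivot_col[OF moves_last(1)]
      pivot_row[OF moves_last(1)] by (meson less_le_trans linorder_le_cases order_trans less_imp_le)
  then show ?case using moves_step[of G i j h a j c E] moves_last by auto
next
  case (moves_step G h r b c A)
  note d = pivotD[OF moves_step(1)]
  have ck: "c \<le> k" using pivot_full[OF moves_step(1), of a k] moves_step.prems d by force
  have p: "pivot G i j h r b c"
    unfolding pivot_def using d ck moves_step.prems pivot_full[OF moves_step(1)] pivot_col[OF moves_step(1)]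
      pivot_row[OF moves_step(1)] by (meson less_le_trans linorder_le_cases order_trans less_imp_le)
  \<comment> \<open>A move out of row \<open>a\<close> vacates \<open>(a, b)\<close>, which becomes
    the new bound of the full block.\<close>
  let ?k = "if r = a then b else k"
  have "moves i j (shift G r b h c) E"
  proof (rule moves_step.IH[OF moves_step.prems(1,2), of ?k])
    show "j < ?k" using d moves_step by auto
    show "(a, ?k) \<notin> shift G r b h c" using d moves_step.prems by (auto simp: mem_shift)
    fix x y assume "a \<le> x" "x \<le> i" "j \<le> y" "y < ?k"
    then show "(x, y) \<in> shift G r b h c"
      using d ck moves_step.prems(5)[of x y] by (auto simp: mem_shift split: if_splits)
  qed
  then show ?case using moves.moves_step[OF p] d moves_step.prems by auto
qed

text \<open>The bumps that can bound the pivot lie only in row \<open>h\<close> and at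
  \<open>(i, k)\<close>. This forces its row and column, and the last bump of row \<open>h\<close>
  before \<open>k\<close> is the same whether the search stops at column \<open>b\<close> or at
  column \<open>j\<close>.\<close>

lemma pivot_right_of_full_column:
  assumes p: "pivot G i b h' r s c" and "j < b" "b < k" "h < i" "(h, j) \<notin> G" "(h, b) \<notin> G" "(i, k) \<notin> G"
    and full: "\<And>x y. h < x \<Longrightarrow> x \<le> i \<Longrightarrow> j \<le> y \<Longrightarrow> y < k \<Longrightarrow> (x, y) \<in> G"
    and col: "\<And>x. h < x \<Longrightarrow> x < i \<Longrightarrow> (x, k) \<in> G"
  shows "h' = h \<and> r = i \<and> c = k \<and> pivot G i j h i s k"
proof -
  note d = pivotD[OF p]
  have h: "h' = h"
  proof (cases h' h rule: linorder_cases)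
    case less
    then show ?thesis using pivot_full[OF p, of h b] d assms by auto
  next
    case greater
    then show ?thesis using full[of h' b] d assms by auto
  qed auto
  have c: "c = k"
  proof (cases c k rule: linorder_cases)
    case less
    then show ?thesis using full[of r c] d h assms by auto
  next
    case greater
    then show ?thesis using pivot_full[OF p, of i k] d h assms by auto
  qed auto
  have r: "r = i" using col[of r] d h c by force
  have "pivot G i j h i s k"
    unfolding pivot_def using d h c r assms pivot_row[OF p] by auto
  with h c r show ?thesis by simp
qed

lemma moves_via_column:
  assumes "moves i b G A" "moves i j A E" "j < b" "b < k" "h < i" "(h, j) \<notin> G" "(h, b) \<notin> G" "(i, k) \<notin> G"
    "\<And>x y. h < x \<Longrightarrow> x \<le> i \<Longrightarrow> j \<le> y \<Longrightarrow> y < k \<Longrightarrow> (x, y) \<in> G"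
    "\<And>x. h < x \<Longrightarrow> x < i \<Longrightarrow> (x, k) \<in> G"
  shows "moves i j G E"
  using assms
proof (induction arbitrary: k rule: moves.induct)
  case (moves_last G h' c)
  note p = pivot_right_of_full_column[OF moves_last(1,3-)]
  then have e: "h' = h" "c = k" and p': "pivot G i j h i b k" by auto
  have "(i, b) \<noteq> (i, j)" using moves_last(3) by auto
  then show ?case using moves_step[OF p'] moves_last(2) e by simp
next
  case (moves_step G h' r s c A)
  have e: "h' = h" "r = i" "c = k" and p: "pivot G i j h i s k"
    using pivot_right_of_full_column[OF moves_step(1) moves_step.prems(2-)] by auto
  note d = pivotD[OF moves_step(1)]
  have "b < s" using d moves_step(2) e by auto
  \<comment> \<open>The vacated \<open>(i, s)\<close> takes over the role of \<open>(i, k)\<close>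
    as the first bump of row \<open>i\<close>.\<close>
  have "moves i j (shift G r s h' c) E"
    by (rule moves_step.IH[OF moves_step.prems(1,2), of s])
      (use moves_step.prems(2-) e d \<open>b < s\<close> in \<open>auto simp: mem_shift\<close>)
  then show ?case using moves.moves_step[OF p] e \<open>b < s\<close> moves_step.prems(2) by auto
qed

subsection \<open>Pipe labels\<close>

text \<open>
  \<open>T r c\<close> is the label of the pipe entering tile \<open>(r, c)\<close> through its top edge and \<open>R r c\<close> that of the
  pipe entering it through its right edge, so the pipe leaving row \<open>r\<close> is \<open>R r 0\<close>.
\<close>

definition labelling :: "(nat \<times> nat) set \<Rightarrow> (nat \<Rightarrow> nat \<Rightarrow> nat) \<Rightarrow> (nat \<Rightarrow> nat \<Rightarrow> nat) \<Rightarrow> bool" where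
  "labelling D T R \<longleftrightarrow> (\<forall>c\<ge>1. T 1 c = c) \<and>
     (\<forall>r\<ge>1. \<forall>c. R r c = (if (r, Suc c) \<in> D then R r (Suc c) else T r (Suc c))) \<and>
     (\<forall>r\<ge>1. \<forall>c\<ge>1. T (Suc r) c = (if (r, c) \<in> D then T r c else R r c))"

lemma labellingD:
  assumes "labelling D T R"
  shows "1 \<le> c \<Longrightarrow> T (Suc 0) c = c"
    and "1 \<le> r \<Longrightarrow> (r, Suc c) \<in> D \<Longrightarrow> R r c = R r (Suc c)"
    and "1 \<le> r \<Longrightarrow> (r, Suc c) \<notin> D \<Longrightarrow> R r c = T r (Suc c)"
    and "1 \<le> r \<Longrightarrow> 1 \<le> c \<Longrightarrow> (r, c) \<in> D \<Longrightarrow> T (Suc r) c = T r c"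
    and "1 \<le> r \<Longrightarrow> 1 \<le> c \<Longrightarrow> (r, c) \<notin> D \<Longrightarrow> T (Suc r) c = R r c"
  using assms unfolding labelling_def by auto

lemma label_of_entering_pipe:
  assumes "labelling D T R" "pipe_enters D x i j s"
  shows "1 \<le> i \<and> (case s of From_Top \<Rightarrow> 1 \<le> j \<and> T i j = x | From_Right \<Rightarrow> R i j = x)"
  using assms(2)
  by induction (auto simp: labellingD[OF assms(1)])

text \<open>The label on a right edge is passed on from the tile further right, so the induction on
  \<open>c\<close> descends from a column beyond all crosses.\<close>

lemma label_enters_right:
  assumes lab: "labelling D T R" and "finite D" and "1 \<le> r"
    and top: "\<And>c. 1 \<le> c \<Longrightarrow> pipe_enters D (T r c) r c From_Top"
  shows "pipe_enters D (R r c) r c From_Right"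
proof -
  have "finite (snd ` D)" using \<open>finite D\<close> by simp
  then obtain N where "\<forall>b\<in>snd ` D. b < N" by (meson finite_nat_set_iff_bounded)
  then have N: "\<And>a b. (a, b) \<in> D \<Longrightarrow> b < N" by force
  have far: "pipe_enters D (R r c) r c From_Right" if "N \<le> c" for c
  proof -
    have "(r, Suc c) \<notin> D" using N[of r "Suc c"] that by auto
    then show ?thesis using top[of "Suc c"] bump_top labellingD(3)[OF lab] \<open>1 \<le> r\<close> by auto
  qed
  show ?thesis
  proof (cases "N \<le> c")
    case False
    then have "c \<le> N" by simp
    then show ?thesis
    proof (induction rule: inc_induct)
      case (step c)
      then show ?case using top[of "Suc c"] bump_top cross_right labellingD(2,3)[OF lab] \<open>1 \<le> r\<close>
        by (cases "(r, Suc c) \<in> D") auto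
    qed (use far in auto)
  qed (use far in auto)
qed

lemma label_enters:
  assumes lab: "labelling D T R" and "finite D" and "1 \<le> r"
  shows "1 \<le> c \<Longrightarrow> pipe_enters D (T r c) r c From_Top" and "pipe_enters D (R r c) r c From_Right"
proof -
  have "\<forall>c\<ge>1. pipe_enters D (T r c) r c From_Top" using \<open>1 \<le> r\<close>
  proof (induction rule: dec_induct)
    case base
    then show ?case using pipe_enters.start labellingD(1)[OF lab] by auto
  next
    case (step r)
    have R: "pipe_enters D (R r c) r c From_Right" for c
      using label_enters_right[OF lab \<open>finite D\<close>] step by auto
    show ?case
    proof (intro allI impI)
      fix c :: nat assume "1 \<le> c"
      then obtain c' where c': "c = Suc c'" by (cases c) auto
      show "pipe_enters D (T (Suc r) c) (Suc r) c From_Top"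
        using step R[of c] labellingD(4,5)[OF lab, of r c] cross_top bump_right \<open>1 \<le> c\<close>
        by (cases "(r, c) \<in> D") (auto simp: c')
    qed
  qed
  then show top: "1 \<le> c \<Longrightarrow> pipe_enters D (T r c) r c From_Top" for c by blast
  show "pipe_enters D (R r c) r c From_Right"
    using label_enters_right[OF lab assms(2,3) top] .
qed

lemma has_permutation_labelling:
  assumes "labelling D T R" "finite D"
  shows "has_permutation D w \<longleftrightarrow> (\<forall>i\<ge>1. w i = R i 0)"
  unfolding has_permutation_def pipe_exits_def
  using label_of_entering_pipe[OF assms(1), where s = From_Right] label_enters(2)[OF assms] by fastforce

text \<open>The pipe on the right edge of \<open>(r, c)\<close> turned into row \<open>r\<close> at
  this column.\<close>

definition next_bump :: "(nat \<times> nat) set \<Rightarrow> nat \<Rightarrow> nat \<Rightarrow> nat" where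
  "next_bump D r c = (LEAST c'. c < c' \<and> (r, c') \<notin> D)"

text \<open>The row index is shifted: \<open>top_label D r\<close> gives the labels below row
  \<open>r\<close>, that is \<open>T (Suc r)\<close>.\<close>

primrec top_label :: "(nat \<times> nat) set \<Rightarrow> nat \<Rightarrow> nat \<Rightarrow> nat" where
  "top_label D 0 c = c"
| "top_label D (Suc r) c =
    (if (Suc r, c) \<in> D then top_label D r c else top_label D r (next_bump D (Suc r) c))"

lemma next_bump_Suc:
  assumes "finite D"
  shows "next_bump D r c = (if (r, Suc c) \<in> D then next_bump D r (Suc c) else Suc c)"
proof (cases "(r, Suc c) \<in> D")
  case True
  then have "(c < c' \<and> (r, c') \<notin> D) \<longleftrightarrow> (Suc c < c' \<and> (r, c') \<notin> D)" for c'
    by (metis Suc_lessD Suc_lessI)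
  then show ?thesis using True by (simp add: next_bump_def)
next
  case False
  then show ?thesis unfolding next_bump_def by (auto intro!: Least_equality)
qed

lemma labelling_exists:
  assumes "finite D"
  shows "\<exists>T R. labelling D T R"
proof -
  have "labelling D (\<lambda>r. top_label D (r - 1)) (\<lambda>r c. top_label D (r - 1) (next_bump D r c))"
    unfolding labelling_def
  proof (intro conjI allI impI)
    fix r c :: nat assume "1 \<le> r"
    then obtain r' where r': "r = Suc r'" by (cases r) auto
    show "top_label D (Suc r - 1) c = (if (r, c) \<in> D then top_label D (r - 1) c
        else top_label D (r - 1) (next_bump D r c))" by (simp add: r')
    show "top_label D (r - 1) (next_bump D r c) = (if (r, Suc c) \<in> D then
        top_label D (r - 1) (next_bump D r (Suc c)) else top_label D (r - 1) (Suc c))"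
      using next_bump_Suc[OF assms, of r c] by simp
  qed simp
  then show ?thesis by blast
qed

text \<open>
  This covers both ladder moves (\<open>(h, k) \<notin> D\<close>) and the removal of a double crossing (\<open>(h, k) \<in> D\<close>).
  In both cases the two pipes that bound the rectangle are exchanged along its boundary.
\<close>

lemma permutation_toggle_corners:
  assumes "finite D" "finite D'" and w: "has_permutation D w"
    and pos: "1 \<le> h" "h < i" "1 \<le> j" "j < k"
    and corners: "(i, j) \<in> D" "(h, j) \<notin> D" "(i, k) \<notin> D"
    and full: "\<And>x y. h \<le> x \<Longrightarrow> x \<le> i \<Longrightarrow> j \<le> y \<Longrightarrow> y \<le> k \<Longrightarrow>
      (x, y) \<notin> {(h, j), (i, k), (h, k)} \<Longrightarrow> (x, y) \<in> D"
    and "(i, j) \<notin> D'" and hk: "(h, k) \<in> D' \<longleftrightarrow> (h, k) \<notin> D"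
    and same: "\<And>x y. (x, y) \<noteq> (i, j) \<Longrightarrow> (x, y) \<noteq> (h, k) \<Longrightarrow> (x, y) \<in> D' \<longleftrightarrow> (x, y) \<in> D"
  shows "has_permutation D' w"
proof -
  obtain T R where lab: "labelling D T R" using labelling_exists[OF \<open>finite D\<close>] by blast
  note L = labellingD[OF lab]
  \<comment> \<open>\<open>A\<close> labels the pipe along the top row and the left column of the
    rectangle, \<open>B\<close> the one along the right column and the bottom row. \<open>T'\<close>
    and \<open>R'\<close> exchange the two labels on exactly these edges.\<close>
  define A where "A = R h (k - 1)"
  define B where "B = T (Suc h) k"
  define T' where "T' r c = (if c = j \<and> h < r \<and> r \<le> i then B else if c = k \<and> h < r \<and> r \<le> i then A else T r c)" for r c
  define R' where "R' r c = (if r = h \<and> j \<le> c \<and> c < k then B else if r = i \<and> j \<le> c \<and> c < k then A else R r c)" for r c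
  have Rh: "R h c = A" if "j \<le> c" "c < k" for c
  proof -
    have "c \<le> k - 1" using that by simp
    then show ?thesis using \<open>j \<le> c\<close>
    proof (induction rule: inc_induct)
      case (step c)
      then have "(h, Suc c) \<in> D" using full[of h "Suc c"] \<open>h < i\<close> by auto
      then show ?case using step L(2)[of h c] \<open>1 \<le> h\<close> by auto
    qed (simp add: A_def)
  qed
  have Tj: "T r j = A" if "h < r" "r \<le> i" for r
  proof -
    have "Suc h \<le> r" using that by simp
    then show ?thesis using \<open>r \<le> i\<close>
    proof (induction rule: dec_induct)
      case base
      then show ?case using L(5)[of h j] Rh[of j] pos corners by simp
    next
      case (step r)
      then have "(r, j) \<in> D" using full[of r j] \<open>j < k\<close> by auto
      then show ?case using step L(4)[of r j] pos by simp
    qed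
  qed
  have Tk: "T r k = B" if "h < r" "r \<le> i" for r
  proof -
    have "Suc h \<le> r" using that by simp
    then show ?thesis using \<open>r \<le> i\<close>
    proof (induction rule: dec_induct)
      case (step r)
      then have "(r, k) \<in> D" using full[of r k] \<open>j < k\<close> by auto
      then show ?case using step L(4)[of r k] pos by simp
    qed (simp add: B_def)
  qed
  have Ri: "R i c = B" if "j \<le> c" "c < k" for c
  proof -
    have "c \<le> k - 1" using that by simp
    then show ?thesis using \<open>j \<le> c\<close>
    proof (induction rule: inc_induct)
      case base
      then show ?case using L(3)[of i "k - 1"] Tk[of i] pos corners by simp
    next
      case (step c)
      then have "(i, Suc c) \<in> D" using full[of i "Suc c"] \<open>h < i\<close> by auto
      then show ?case using step L(2)[of i c] pos by simp
    qed
  qed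
  \<comment> \<open>\<open>A\<close> and \<open>B\<close> are the two labels entering the corner
    \<open>(h, k)\<close>, in an order decided by its tile; toggling that tile exchanges
    them.\<close>
  have A: "A = (if (h, k) \<in> D then R h k else T h k)"
    unfolding A_def using L(2,3)[of h "k - 1"] pos by simp
  have B: "B = (if (h, k) \<in> D then T h k else R h k)"
    unfolding B_def using L(4,5)[of h k] pos by simp
  have "labelling D' T' R'"
    unfolding labelling_def
  proof (intro conjI allI impI)
    fix c :: nat assume "1 \<le> c"
    then show "T' 1 c = c" unfolding T'_def using L(1) \<open>1 \<le> h\<close> by auto
  next
    fix r c :: nat assume r: "1 \<le> r"
    show "R' r c = (if (r, Suc c) \<in> D' then R' r (Suc c) else T' r (Suc c))"
    proof (cases "(r = h \<or> r = i) \<and> j \<le> c \<and> c < k")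
      case zone: True
      show ?thesis
      proof (cases "Suc c = k")
        case ck: True
        have ik: "(i, k) \<notin> D'" using same[of i k] \<open>(i, k) \<notin> D\<close> \<open>h < i\<close> \<open>j < k\<close> by simp
        show ?thesis
        proof (cases "r = h")
          case True
          then have "R' r c = B" "R' r (Suc c) = R h k" "T' r (Suc c) = T h k"
            using \<open>h < i\<close> \<open>j < k\<close> ck zone by (simp_all add: R'_def T'_def)
          then show ?thesis using B hk ck True by simp
        next
          case False
          then have "r = i" using zone by simp
          then have "R' r c = A" "T' r (Suc c) = A"
            using \<open>h < i\<close> \<open>j < k\<close> ck zone by (simp_all add: R'_def T'_def)
          then show ?thesis using ck ik \<open>r = i\<close> by simp
        qed
      next
        case False
        then have c: "j \<le> c" "Suc c < k" using zone by auto
        then have "(r, Suc c) \<in> D" using full[of r "Suc c"] zone \<open>h < i\<close> by auto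
        then have "(r, Suc c) \<in> D'" using same[of r "Suc c"] c by auto
        then show ?thesis using zone c by (auto simp: R'_def)
      qed
    next
      case out: False
      have R: "R r c = (if (r, Suc c) \<in> D then R r (Suc c) else T r (Suc c))" using L(2,3) r by auto
      have R': "R' r c = R r c" using out by (auto simp: R'_def)
      show ?thesis
      proof (cases "(r, Suc c) = (i, j)")
        case True
        then show ?thesis using R R' Ri[of j] \<open>(i, j) \<in> D\<close> \<open>(i, j) \<notin> D'\<close> \<open>j < k\<close> \<open>h < i\<close> by (auto simp: T'_def)
      next
        case ne: False
        have "(r, Suc c) \<noteq> (h, k)" using out \<open>j < k\<close> by auto
        then have eq: "(r, Suc c) \<in> D' \<longleftrightarrow> (r, Suc c) \<in> D" using same[OF ne] by simp
        show ?thesis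
        proof (cases "(r, Suc c) \<in> D")
          case True
          have "\<not> ((r = h \<or> r = i) \<and> Suc c = j)" using True ne \<open>(h, j) \<notin> D\<close> by auto
          then have "\<not> ((r = h \<or> r = i) \<and> j \<le> Suc c \<and> Suc c < k)" using out by linarith
          then have "R' r (Suc c) = R r (Suc c)" by (auto simp: R'_def)
          then show ?thesis using True R R' eq by simp
        next
          case False
          have "\<not> (Suc c = j \<and> h < r \<and> r \<le> i)"
            using full[of r j] False ne \<open>j < k\<close> by auto
          moreover have "\<not> (Suc c = k \<and> h < r \<and> r \<le> i)"
            using full[of r k] False out \<open>j < k\<close> by (cases "r = i") auto
          ultimately have "T' r (Suc c) = T r (Suc c)" unfolding T'_def by (simp only: if_False)
          then show ?thesis using False R R' eq by simp
        qed
      qed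
    qed
  next
    fix r c :: nat assume r: "1 \<le> r" and c: "1 \<le> c"
    show "T' (Suc r) c = (if (r, c) \<in> D' then T' r c else R' r c)"
    proof (cases "(c = j \<or> c = k) \<and> h \<le> r \<and> r < i")
      case zone: True
      show ?thesis
      proof (cases "r = h")
        case rh: True
        have hj: "(h, j) \<notin> D'" using same[of h j] \<open>(h, j) \<notin> D\<close> \<open>h < i\<close> \<open>j < k\<close> by simp
        show ?thesis
        proof (cases "c = k")
          case True
          then have "T' (Suc r) c = A" "T' r c = T h k" "R' r c = R h k"
            using \<open>h < i\<close> \<open>j < k\<close> rh by (simp_all add: R'_def T'_def)
          then show ?thesis using A hk rh True by simp
        next
          case False
          then have "c = j" using zone by simp
          then have "T' (Suc r) c = B" "R' r c = B"
            using \<open>h < i\<close> \<open>j < k\<close> rh by (simp_all add: R'_def T'_def)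
          then show ?thesis using rh hj \<open>c = j\<close> by simp
        qed
      next
        case False
        then have r: "h < r" "r < i" using zone by auto
        then have "(r, c) \<in> D" using full[of r c] zone \<open>j < k\<close> by auto
        then have "(r, c) \<in> D'" using same[of r c] r by auto
        then show ?thesis using zone r by (auto simp: T'_def)
      qed
    next
      case out: False
      have T: "T (Suc r) c = (if (r, c) \<in> D then T r c else R r c)" using L(4,5) r c by auto
      have T': "T' (Suc r) c = T (Suc r) c" using out by (auto simp: T'_def)
      show ?thesis
      proof (cases "(r, c) = (i, j)")
        case True
        then show ?thesis using T T' Tj[of i] \<open>(i, j) \<in> D\<close> \<open>(i, j) \<notin> D'\<close> \<open>j < k\<close> \<open>h < i\<close> by (auto simp: R'_def)
      next
        case ne: False
        have "(r, c) \<noteq> (h, k)" using out \<open>h < i\<close> by auto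
        then have eq: "(r, c) \<in> D' \<longleftrightarrow> (r, c) \<in> D" using same[OF ne] by simp
        show ?thesis
        proof (cases "(r, c) \<in> D")
          case True
          have "\<not> ((c = j \<or> c = k) \<and> r = i)" using True ne \<open>(i, k) \<notin> D\<close> by auto
          then have "\<not> ((c = j \<or> c = k) \<and> h < r \<and> r \<le> i)" using out by linarith
          then have "T' r c = T r c" by (auto simp: T'_def)
          then show ?thesis using True T T' eq by simp
        next
          case False
          have "\<not> (r = h \<and> j \<le> c \<and> c < k)"
            using full[of h c] False out \<open>h < i\<close> by (cases "c = j") auto
          moreover have "\<not> (r = i \<and> j \<le> c \<and> c < k)"
            using full[of i c] False ne \<open>h < i\<close> by (cases "c = j") auto
          ultimately have "R' r c = R r c" unfolding R'_def by (simp only: if_False)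
          then show ?thesis using False T T' eq by simp
        qed
      qed
    qed
  qed
  \<comment> \<open>Since \<open>1 \<le> j\<close>, the exchange ends at \<open>(i, j)\<close> and
    does not reach the left boundary.\<close>
  moreover have "R' x 0 = R x 0" for x unfolding R'_def using \<open>1 \<le> j\<close> by simp
  ultimately show ?thesis
    using w has_permutation_labelling[OF lab \<open>finite D\<close>] has_permutation_labelling[OF _ \<open>finite D'\<close>] by metis
qed

subsection \<open>Reduced words\<close>

text \<open>Composition on the right lets the letter \<open>m\<close> exchange the values at
  positions \<open>m\<close> and \<open>Suc m\<close>, which is how a cross acts on a list of
  labels.\<close>

definition word_perm :: "nat list \<Rightarrow> nat \<Rightarrow> nat" where
  "word_perm ms = foldl (\<lambda>v m. v \<circ> Transposition.transpose m (Suc m)) id ms"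

lemma word_perm_simps [simp]:
  "word_perm [] = id"
  "word_perm (ms @ [m]) = word_perm ms \<circ> Transposition.transpose m (Suc m)"
  by (simp_all add: word_perm_def)

lemma inj_word_perm: "inj (word_perm ms)"
proof (induction ms rule: rev_induct)
  case (snoc m ms)
  then show ?case unfolding word_perm_simps using bij_is_inj[OF bij_transpose] by (rule inj_compose)
qed simp

lemma inversions_cong: "(\<And>m. 1 \<le> m \<Longrightarrow> v m = w m) \<Longrightarrow> inversions v = inversions w"
  unfolding inversions_def by auto

text \<open>After renaming positions by the transposition, every inversion of \<open>v'\<close>
  other than \<open>(m, Suc m)\<close> is one of \<open>v\<close>.\<close>

lemma inversions_transpose:
  assumes "finite (inversions v)" "1 \<le> m"
  defines "v' \<equiv> v \<circ> Transposition.transpose m (Suc m)"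
  shows "finite (inversions v')" "card (inversions v') \<le> Suc (card (inversions v))"
    "\<not> v m < v (Suc m) \<Longrightarrow> card (inversions v') \<le> card (inversions v)"
proof -
  let ?t = "Transposition.transpose m (Suc m)"
  have sub: "inversions v' - {(m, Suc m)} \<subseteq> map_prod ?t ?t ` inversions v"
  proof
    fix u assume "u \<in> inversions v' - {(m, Suc m)}"
    then obtain x y where u: "u = (x, y)" "1 \<le> x" "x < y" "v (?t y) < v (?t x)" "(x, y) \<noteq> (m, Suc m)"
      unfolding inversions_def v'_def by auto
    have "?t x < ?t y" "1 \<le> ?t x" using u \<open>1 \<le> m\<close> by (auto simp: transpose_def)
    then have "(?t x, ?t y) \<in> inversions v" unfolding inversions_def using u by auto
    moreover have "u = map_prod ?t ?t (?t x, ?t y)" using u by simp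
    ultimately show "u \<in> map_prod ?t ?t ` inversions v" by blast
  qed
  have fin: "finite (map_prod ?t ?t ` inversions v)" using assms by simp
  have le: "card (map_prod ?t ?t ` inversions v) \<le> card (inversions v)" using assms card_image_le by blast
  have f: "finite (inversions v' - {(m, Suc m)})" using sub fin finite_subset by blast
  then show "finite (inversions v')" by simp
  have c: "card (inversions v' - {(m, Suc m)}) \<le> card (inversions v)"
    using card_mono[OF fin sub] le by simp
  then show "card (inversions v') \<le> Suc (card (inversions v))"
    using f by (cases "(m, Suc m) \<in> inversions v'") (auto simp: card_Diff_singleton)
  assume "\<not> v m < v (Suc m)"
  then have "(m, Suc m) \<notin> inversions v'" unfolding inversions_def v'_def by simp
  then show "card (inversions v') \<le> card (inversions v)" using c by simp
qed

lemma inversions_word_perm: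
  assumes "\<forall>m\<in>set ms. 1 \<le> m"
  shows "finite (inversions (word_perm ms)) \<and> card (inversions (word_perm ms)) \<le> length ms"
  using assms
proof (induction ms rule: rev_induct)
  case Nil
  have e: "inversions (word_perm []) = {}" unfolding inversions_def by auto
  show ?case unfolding e by simp
next
  case (snoc m ms)
  then have "finite (inversions (word_perm ms))" "card (inversions (word_perm ms)) \<le> length ms" "1 \<le> m"
    by auto
  then show ?case using inversions_transpose(1,2)[of "word_perm ms" m]
    unfolding word_perm_simps length_append_singleton by (meson Suc_le_mono order_trans)
qed

text \<open>Each letter of a reduced word creates an inversion, so the last letter \<open>m\<close>
  is a descent of the product. If \<open>n \<le> m\<close>, then \<open>Suc m\<close> is fixed, the
  value at \<open>m\<close> exceeds it and so is fixed too, and injectivity makes \<open>m\<close> a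
  fixed point, which is no descent.\<close>

lemma reduced_word_letters:
  assumes "\<forall>m\<in>set ms. 1 \<le> m" "card (inversions (word_perm ms)) = length ms"
    and "\<And>m. n < m \<Longrightarrow> word_perm ms m = m"
  shows "\<forall>m\<in>set ms. m < n"
  using assms
proof (induction ms rule: rev_induct)
  case Nil
  then show ?case by simp
next
  case (snoc m ms)
  let ?v = "word_perm ms" and ?v' = "word_perm (ms @ [m])"
  have m: "1 \<le> m" using snoc.prems by simp
  note inv = inversions_word_perm[of ms]
  have fin: "finite (inversions ?v)" and len: "card (inversions ?v) \<le> length ms" using inv snoc.prems by auto
  note tr = inversions_transpose[OF fin m]
  have len': "card (inversions (?v \<circ> Transposition.transpose m (Suc m))) = Suc (length ms)"
    using snoc.prems(2) by (simp only: word_perm_simps length_append_singleton)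
  have card: "card (inversions ?v) = length ms" using tr(2) len len' by linarith
  have "?v m < ?v (Suc m)"
  proof (rule ccontr)
    assume "\<not> ?v m < ?v (Suc m)"
    from tr(3)[OF this] show False using card len' by linarith
  qed
  then have desc: "?v' (Suc m) < ?v' m" by simp
  have "m < n"
  proof (rule ccontr)
    assume "\<not> m < n"
    then have 1: "?v' (Suc m) = Suc m" using snoc.prems(3)[of "Suc m"] by simp
    then have "n < ?v' m" using desc \<open>\<not> m < n\<close> by simp
    then have "?v' (?v' m) = ?v' m" using snoc.prems(3) by blast
    then have "?v' m = m" using inj_word_perm[of "ms @ [m]"] by (meson injD)
    then show False using desc 1 by simp
  qed
  moreover have "?v x = x" if "n < x" for x
    using snoc.prems(3)[OF that] that \<open>m < n\<close> by (simp add: transpose_def)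
  ultimately show ?case using snoc.IH snoc.prems(1) card by simp
qed

text \<open>
  The tile \<open>(a, b)\<close> acts on the pipes at the antidiagonal positions \<open>a + b - 1\<close> and \<open>a + b\<close>. Below, \<open>V i j\<close>
  lists the labels by antidiagonal position after the rows above \<open>i\<close> and the columns right of \<open>j\<close>
  in row \<open>i\<close> have been traversed.
\<close>

lemma reading_word:
  assumes lab: "labelling D T R" and "pipe_dream D"
  shows "\<exists>ms. length ms = card D \<and> set ms = (\<lambda>(a, b). a + b - 1) ` D \<and> (\<forall>m\<ge>1. word_perm ms m = R m 0)"
proof -
  note L = labellingD[OF lab]
  have fin: "finite D" and pos: "\<And>a b. (a, b) \<in> D \<Longrightarrow> 1 \<le> a \<and> 1 \<le> b"
    using assms unfolding pipe_dream_def by auto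
  have "finite (fst ` D \<union> snd ` D)" using fin by simp
  then obtain N where "\<forall>b\<in>fst ` D \<union> snd ` D. b < N" by (meson finite_nat_set_iff_bounded)
  then have N: "a < N \<and> b < N" if "(a, b) \<in> D" for a b using that by force
  define P where "P i j = {(a, b) \<in> D. a < i \<or> (a = i \<and> j < b)}" for i j
  \<comment> \<open>The four ranges are the rows already left, the top edges of the columns up to
    \<open>j\<close> in row \<open>i\<close>, the edge to the right of column \<open>j\<close>, and
    the bottom edges beyond it.\<close>
  define V where "V i j m = (if m < i then R m 0 else if m < i + j then T i (Suc m - i)
      else if m = i + j then R i j else T (Suc i) (m - i))" for i j m
  define good where "good i j \<longleftrightarrow> (\<exists>ms. length ms = card (P i j) \<and> set ms = (\<lambda>(a, b). a + b - 1) ` P i j \<and>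
      (\<forall>m\<ge>1. word_perm ms m = V i j m))" for i j
  have finP: "finite (P i j)" for i j unfolding P_def using fin by (rule rev_finite_subset) auto
  have far: "R r c = T r (Suc c)" "N \<le> c' \<Longrightarrow> 1 \<le> c' \<Longrightarrow> T (Suc r) c' = R r c'" if "1 \<le> r" "N \<le> Suc c" for r c c'
    using that N L(3)[of r c] L(5)[of r c'] by force+
  have start: "good 1 N"
  proof -
    have "V 1 N m = m" if "1 \<le> m" for m
    proof -
      have "T (Suc (Suc 0)) (m - 1) = T (Suc 0) m" if "Suc N < m"
        using that far(1)[of 1 "m - 1"] far(2)[of 1 "m - 1" "m - 1"] by simp
      moreover have "R 1 N = T 1 (Suc N)" using far(1) by simp
      ultimately show ?thesis using that L(1) unfolding V_def by auto
    qed
    moreover have "P 1 N = {}" unfolding P_def using pos N by force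
    ultimately show ?thesis unfolding good_def by (intro exI[of _ "[]"]) simp
  qed
  \<comment> \<open>Passing the tile \<open>(i, Suc j)\<close> appends the letter
    \<open>i + j\<close> if it is a cross and leaves \<open>V\<close> unchanged if it is a
    bump.\<close>
  have left: "good i j" if g: "good i (Suc j)" and i: "1 \<le> i" for i j
  proof -
    obtain ms where ms: "length ms = card (P i (Suc j))" "set ms = (\<lambda>(a, b). a + b - 1) ` P i (Suc j)"
      "\<forall>m\<ge>1. word_perm ms m = V i (Suc j) m"
      using g unfolding good_def by blast
    show ?thesis
    proof (cases "(i, Suc j) \<in> D")
      case True
      have P: "P i j = insert (i, Suc j) (P i (Suc j))" unfolding P_def using True by auto
      have nP: "(i, Suc j) \<notin> P i (Suc j)" unfolding P_def by auto
      have V: "V i j m = V i (Suc j) (Transposition.transpose (i + j) (Suc (i + j)) m)" for m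
        using L(2)[OF i True] L(4)[OF i _ True] unfolding V_def transpose_def by auto
      have "1 \<le> Transposition.transpose (i + j) (Suc (i + j)) m" if "1 \<le> m" for m
        using that \<open>1 \<le> i\<close> by (auto simp: transpose_def)
      then have "word_perm (ms @ [i + j]) m = V i j m" if "1 \<le> m" for m
        using that ms(3) V by simp
      then show ?thesis unfolding good_def using ms(1,2) P nP finP
        by (intro exI[of _ "ms @ [i + j]"]) auto
    next
      case False
      have P: "P i j = P i (Suc j)" unfolding P_def using False by (auto intro: Suc_lessI le_neq_implies_less[OF Suc_leI])
      have V: "V i j m = V i (Suc j) m" for m
        using L(3)[OF i False] L(5)[OF i _ False] unfolding V_def
        by (cases "m = i + j"; cases "m = Suc (i + j)") (auto simp: Suc_diff_le)
      show ?thesis using g unfolding good_def P V .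
    qed
  qed
  have down: "good (Suc i) N" if "good i 0" "1 \<le> i" for i
  proof -
    have P: "P (Suc i) N = P i 0" unfolding P_def using N pos by force
    have V: "V (Suc i) N m = V i 0 m" if "1 \<le> m" for m
    proof -
      have "T (Suc (Suc i)) (m - Suc i) = T (Suc i) (m - i)" if "Suc i + N < m"
        using that far(1)[of "Suc i" "m - Suc i"] far(2)[of "Suc i" "m - Suc i" "m - Suc i"]
        by (simp add: Suc_diff_Suc)
      moreover have "R (Suc i) N = T (Suc i) (Suc N)" using far(1) by simp
      ultimately show ?thesis unfolding V_def by (auto simp: Suc_diff_le)
    qed
    show ?thesis using that(1) V unfolding good_def P by auto
  qed
  have row: "good i 0" if "good i N" "1 \<le> i" for i
  proof -
    have "0 \<le> N" by simp
    then show ?thesis by (induction rule: inc_induct) (use that left in auto)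
  qed
  have "good i N" if "1 \<le> i" for i
    using that by (induction rule: dec_induct) (use start down row in auto)
  then have "good (Suc N) 0" using row by simp
  moreover have "P (Suc N) 0 = D" unfolding P_def using N by force
  moreover have "V (Suc N) 0 m = R m 0" if "1 \<le> m" for m
  proof -
    \<comment> \<open>Below all crosses every bump hands a label one position down its
      antidiagonal.\<close>
    have empty: "T (r + d) (Suc c) = T r (Suc c + d)" if "N \<le> r" "1 \<le> r" for r d c
    proof (induction d arbitrary: c)
      case (Suc d)
      have "(r + d, Suc c) \<notin> D" "(r + d, Suc (Suc c)) \<notin> D" using N[of "r + d"] that by force+
      then show ?case using Suc[of "Suc c"] L(3,5)[of "r + d" "Suc c"] that by simp
    qed simp
    have "R m 0 = T (Suc (Suc N)) (m - Suc N)" if "Suc N < m"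
    proof -
      have "(m, Suc 0) \<notin> D" using N[of m] that by force
      then have "R m 0 = T m 1" using L(3)[of m 0] that by simp
      also have "\<dots> = T (Suc (Suc N) + (m - Suc (Suc N))) (Suc 0)"
        using that by (metis One_nat_def Suc_leI le_add_diff_inverse)
      also have "\<dots> = T (Suc (Suc N)) (Suc 0 + (m - Suc (Suc N)))" by (rule empty) simp_all
      also have "Suc 0 + (m - Suc (Suc N)) = m - Suc N" using that by simp
      finally show ?thesis .
    qed
    then show ?thesis unfolding V_def by auto
  qed
  ultimately show ?thesis unfolding good_def by simp
qed

section \<open>Reduced pipe dreams: staircase bound and ladder moves\<close>

lemma RPD_D:
  assumes "D \<in> RPD w"
  shows "pipe_dream D" "finite D" "has_permutation D w" "card D = card (inversions w)"
  using assms unfolding RPD_def pipe_dream_def by auto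

lemma permutation_word:
  assumes "pipe_dream D" "has_permutation D w"
  shows "\<exists>ms. length ms = card D \<and> set ms = (\<lambda>(a, b). a + b - 1) ` D \<and> (\<forall>m\<ge>1. word_perm ms m = w m) \<and>
    (\<forall>m\<in>set ms. 1 \<le> m)"
proof -
  have "finite D" using assms unfolding pipe_dream_def by simp
  then obtain T R where lab: "labelling D T R" using labelling_exists by blast
  obtain ms where ms: "length ms = card D" "set ms = (\<lambda>(a, b). a + b - 1) ` D" "\<forall>m\<ge>1. word_perm ms m = R m 0"
    using reading_word[OF lab assms(1)] by blast
  moreover have "\<forall>m\<in>set ms. 1 \<le> m" using ms(2) assms(1) unfolding pipe_dream_def by fastforce
  moreover have "\<forall>m\<ge>1. word_perm ms m = w m"
    using ms(3) has_permutation_labelling[OF lab \<open>finite D\<close>] assms(2) by simp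
  ultimately show ?thesis by blast
qed

lemma inversions_le_card:
  assumes "pipe_dream D" "has_permutation D w"
  shows "card (inversions w) \<le> card D"
proof -
  obtain ms where ms: "length ms = card D" "\<forall>m\<ge>1. word_perm ms m = w m" "\<forall>m\<in>set ms. 1 \<le> m"
    using permutation_word[OF assms] by blast
  then have "inversions (word_perm ms) = inversions w" using inversions_cong by blast
  then show ?thesis using inversions_word_perm[OF ms(3)] ms(1) by simp
qed

text \<open>The cross \<open>(a, b)\<close> contributes the letter \<open>a + b - 1\<close>, and
  letters of a reduced word for \<open>w\<close> are below \<open>n\<close>. In particular every row
  has a bump in column \<open>n\<close>, which \<open>move_k\<close> relies on.\<close>

lemma RPD_staircase:
  assumes "D \<in> RPD w" "w permutes {1..n}" "(a, b) \<in> D"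
  shows "a + b \<le> n"
proof -
  note D = RPD_D[OF assms(1)]
  obtain ms where ms: "length ms = card D" "set ms = (\<lambda>(a, b). a + b - 1) ` D"
    "\<forall>m\<ge>1. word_perm ms m = w m" "\<forall>m\<in>set ms. 1 \<le> m"
    using permutation_word[OF D(1,3)] by blast
  have "inversions (word_perm ms) = inversions w" using inversions_cong ms(3) by blast
  then have c: "card (inversions (word_perm ms)) = length ms" using D(4) ms(1) by simp
  have "word_perm ms m = m" if "n < m" for m using that ms(3) assms(2) unfolding permutes_def by auto
  then have "\<forall>m\<in>set ms. m < n" using reduced_word_letters[OF ms(4) c] by blast
  then show ?thesis using ms(2) assms(3) by force
qed

lemma RPD_ladder_corner:
  assumes "D \<in> RPD w" and l: "ladder_corner D i j h k"
  shows "insert (h, k) (D - {(i, j)}) \<in> RPD w"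
proof -
  note D = RPD_D[OF assms(1)]
  let ?D = "insert (h, k) (D - {(i, j)})"
  have "has_permutation ?D w"
    by (rule permutation_toggle_corners[OF D(2) _ D(3), of _ h i j k])
      (use l D(2) in \<open>auto simp: ladder_corner_def\<close>)
  moreover have "card ?D = card D"
    using D(2) l card_gt_0_iff[of D] by (auto simp: ladder_corner_def card_Diff_singleton)
  ultimately show ?thesis
    using D l unfolding RPD_def pipe_dream_def ladder_corner_def by auto
qed

text \<open>Deleting both crossings would keep the permutation and leave fewer crosses than
  inversions.\<close>

lemma RPD_no_double_crossing:
  assumes "D \<in> RPD w" "1 \<le> h" "h < i" "1 \<le> j" "j < k" "(i, j) \<in> D" "(h, j) \<notin> D" "(i, k) \<notin> D"
    and full: "\<And>x y. h \<le> x \<Longrightarrow> x \<le> i \<Longrightarrow> j \<le> y \<Longrightarrow> y \<le> k \<Longrightarrow>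
      (x, y) \<notin> {(h, j), (i, k), (h, k)} \<Longrightarrow> (x, y) \<in> D"
  shows "(h, k) \<notin> D"
proof
  assume hk: "(h, k) \<in> D"
  note D = RPD_D[OF assms(1)]
  let ?D = "D - {(i, j), (h, k)}"
  have "has_permutation ?D w"
    by (rule permutation_toggle_corners[OF D(2) _ D(3), of _ h i j k])
      (use assms hk D(2) in auto)
  moreover have "pipe_dream ?D" using D(1) unfolding pipe_dream_def by auto
  ultimately have "card (inversions w) \<le> card ?D" by (rule inversions_le_card[rotated])
  moreover have "?D \<subset> D" using hk by auto
  then have "card ?D < card D" using D(2) psubset_card_mono by blast
  ultimately show False using D(4) by simp
qed

subsection \<open>From pipe dreams to grids\<close>

text \<open>
  Filling the nonpositive rows with crosses makes the top boundary invisible: nothing can be moved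
  there, and a bump lies in a positive row.
\<close>

definition grid :: "(nat \<times> nat) set \<Rightarrow> (int \<times> int) set" where
  "grid D = {(x, y). x \<le> 0 \<or> (nat x, nat y) \<in> D}"

lemma mem_grid_int [simp]: "(int x, int y) \<in> grid D \<longleftrightarrow> x = 0 \<or> (x, y) \<in> D"
  by (simp add: grid_def)

lemma grid_not_mem: "(x, y) \<notin> grid D \<longleftrightarrow> 1 \<le> x \<and> (nat x, nat y) \<notin> D"
  by (auto simp: grid_def)

lemma grid_inj:
  assumes "pipe_dream D" "pipe_dream D'" "grid D = grid D'"
  shows "D = D'"
proof -
  have "(x, y) \<in> D \<longleftrightarrow> (x, y) \<in> D'" for x y
  proof -
    have "(x = 0 \<or> (x, y) \<in> D) \<longleftrightarrow> (x = 0 \<or> (x, y) \<in> D')"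
      using assms(3) mem_grid_int[of x y D] mem_grid_int[of x y D'] by simp
    then show ?thesis using assms(1,2) unfolding pipe_dream_def by force
  qed
  then show ?thesis by auto
qed

lemma grid_shift:
  assumes "1 \<le> i" "1 \<le> j" "1 \<le> h" "1 \<le> k"
  shows "shift (grid D) (int i) (int j) (int h) (int k) = grid (insert (h, k) (D - {(i, j)}))"
  using assms by (auto simp: shift_def grid_def)

text \<open>The bump \<open>(h, j)\<close> forces \<open>1 \<le> h\<close>, so \<open>(i, j)\<close>
  is a genuine cross of \<open>D\<close> and \<open>1 \<le> j\<close>.\<close>

lemma ladder_grid:
  assumes D: "pipe_dream D" and l: "ladder (grid D) i j h k"
  shows "ladder_corner D (nat i) (nat j) (nat h) (nat k) \<and> 1 \<le> h \<and> 1 \<le> j"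
proof -
  note d = ladderD[OF l]
  have h: "1 \<le> h" using d(4) by (simp add: grid_not_mem)
  then have "(nat i, nat j) \<in> D" using d(1,3) by (simp add: grid_def)
  then have j: "1 \<le> j" using D unfolding pipe_dream_def by force
  have full: "(x, y) \<in> D" if "nat h \<le> x" "x \<le> nat i" "nat j \<le> y" "y \<le> nat k"
    "(x, y) \<notin> {(nat h, nat j), (nat i, nat k), (nat h, nat k)}" for x y
  proof -
    have "h \<le> int x" "int x \<le> i" "j \<le> int y" "int y \<le> k" using that d h j by linarith+
    moreover have "\<not> (int x = h \<and> int y = j)" "\<not> (int x = i \<and> int y = k)" "\<not> (int x = h \<and> int y = k)"
      using that(5) by auto
    ultimately have "(int x, int y) \<in> grid D"
      using ladder_hole[OF l, of "int x" "int y"] by blast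
    then show ?thesis using that h by auto
  qed
  have "(nat h, nat j) \<notin> D" "(nat i, nat k) \<notin> D" "(nat h, nat k) \<notin> D"
    using d by (simp_all add: grid_not_mem)
  moreover have "{nat h..nat i} \<times> {nat j..nat k} - {(nat h, nat j), (nat i, nat k), (nat h, nat k)} \<subseteq> D"
  proof
    fix c assume "c \<in> {nat h..nat i} \<times> {nat j..nat k} - {(nat h, nat j), (nat i, nat k), (nat h, nat k)}"
    then show "c \<in> D" using full[of "fst c" "snd c"] by (cases c) simp
  qed
  moreover have "1 \<le> nat h" "nat h < nat i" "1 \<le> nat j" "nat j < nat k" using d(1,2) h j by linarith+
  ultimately show ?thesis
    unfolding ladder_corner_def using h j \<open>(nat i, nat j) \<in> D\<close> by blast
qed

lemma ladder_corner_grid: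
  assumes "ladder_corner D i j h k"
  shows "ladder (grid D) (int i) (int j) (int h) (int k)"
  unfolding ladder_def
proof (intro conjI allI impI)
  fix x y
  assume a: "int h \<le> x" "x \<le> int i" "int j \<le> y" "y \<le> int k"
    "(x, y) \<notin> {(int h, int j), (int i, int k), (int h, int k)}"
  then have "(nat x, nat y) \<in> {h..i} \<times> {j..k} - {(h, j), (i, k), (h, k)}" by auto
  then have "(nat x, nat y) \<in> D" using assms unfolding ladder_corner_def by blast
  then show "(x, y) \<in> grid D" by (simp add: grid_def)
qed (use assms in \<open>auto simp: ladder_corner_def\<close>)

text \<open>A termination measure: a ladder move carries one cross upwards.\<close>

definition row_sum :: "(nat \<times> nat) set \<Rightarrow> nat" where
  "row_sum D = (\<Sum>c\<in>D. fst c)"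

lemma row_sum_ladder:
  assumes "finite D" "ladder_corner D i j h k"
  shows "row_sum (insert (h, k) (D - {(i, j)})) < row_sum D"
proof -
  have "row_sum D = i + row_sum (D - {(i, j)})"
    using assms sum.remove[of D "(i, j)" fst] by (simp add: row_sum_def ladder_corner_def)
  moreover have "row_sum (insert (h, k) (D - {(i, j)})) = h + row_sum (D - {(i, j)})"
    using assms by (simp add: row_sum_def ladder_corner_def)
  ultimately show ?thesis using assms by (simp add: ladder_corner_def)
qed

lemma RPD_grid_no_double_crossing:
  assumes "D \<in> RPD w"
  shows "no_double_crossing (grid D)"
  unfolding no_double_crossing_def
proof (intro allI impI)
  fix h i j k :: int
  assume a: "h < i" "j < k" "(i, j) \<in> grid D" "(h, j) \<notin> grid D" "(i, k) \<notin> grid D"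
    and full: "\<forall>x y. h \<le> x \<longrightarrow> x \<le> i \<longrightarrow> j \<le> y \<longrightarrow> y \<le> k \<longrightarrow>
      (x, y) \<notin> {(h, j), (i, k), (h, k)} \<longrightarrow> (x, y) \<in> grid D"
  have h: "1 \<le> h" using a(4) by (simp add: grid_not_mem)
  then have ij: "(nat i, nat j) \<in> D" using a(1,3) by (simp add: grid_def)
  then have j: "1 \<le> j" using RPD_D(1)[OF assms] unfolding pipe_dream_def by force
  have "(nat h, nat k) \<notin> D"
  proof (rule RPD_no_double_crossing[OF assms, of _ "nat i" "nat j"])
    fix x y assume b: "nat h \<le> x" "x \<le> nat i" "nat j \<le> y" "y \<le> nat k"
      "(x, y) \<notin> {(nat h, nat j), (nat i, nat k), (nat h, nat k)}"
    have "h \<le> int x" "int x \<le> i" "j \<le> int y" "int y \<le> k" using a b h j by linarith+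
    moreover have "(int x, int y) \<notin> {(h, j), (i, k), (h, k)}" using b(5) by auto
    ultimately have "(int x, int y) \<in> grid D" using full by blast
    then show "(x, y) \<in> D" using b h by auto
  qed (use a h j ij in \<open>auto simp: grid_not_mem\<close>)
  then show "(h, k) \<notin> grid D" using h by (simp add: grid_not_mem)
qed

lemma RPD_shift:
  assumes "D \<in> RPD w" "ladder (grid D) i j h k"
  shows "\<exists>D'\<in>RPD w. shift (grid D) i j h k = grid D' \<and> row_sum D' < row_sum D"
proof -
  note D = RPD_D[OF assms(1)]
  note d = ladderD[OF assms(2)]
  have c: "ladder_corner D (nat i) (nat j) (nat h) (nat k)" and pos: "1 \<le> h" "1 \<le> j"
    using ladder_grid[OF D(1) assms(2)] by auto
  have "shift (grid D) i j h k = grid (insert (nat h, nat k) (D - {(nat i, nat j)}))"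
    using grid_shift[of "nat i" "nat j" "nat h" "nat k" D] pos d by simp
  then show ?thesis using RPD_ladder_corner[OF assms(1) c] row_sum_ladder[OF D(2) c] by blast
qed

lemma RPD_admissible: "D \<in> RPD w \<Longrightarrow> admissible (grid D)"
proof (induction "row_sum D" arbitrary: D rule: less_induct)
  case less
  show ?case
  proof (rule admissibleI)
    show "no_double_crossing (grid D)" using RPD_grid_no_double_crossing less(2) .
    fix G' assume "step UNIV (grid D) G'"
    then obtain i j h k where "ladder (grid D) i j h k" "G' = shift (grid D) i j h k"
      unfolding step_def by blast
    then show "admissible G'" using RPD_shift[OF less(2)] less(1) by metis
  qed
qed

section \<open>The recursive operator on reduced pipe dreams\<close>

lemma movable_iff_unblocked:
  assumes "D \<in> RPD w" "w permutes {1..n}"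
  shows "movable D i j \<longleftrightarrow> unblocked (grid D) (int i) (int j)"
proof
  assume m: "movable D i j"
  then obtain h where h: "1 \<le> h" "h < i" "(h, j) \<notin> D" and ij: "(i, j) \<in> D" unfolding movable_def by auto
  have le: "i + j \<le> n" using RPD_staircase[OF assms ij] .
  have "(i, n) \<notin> D" using RPD_staircase[OF assms, of i n] h by auto
  then show "unblocked (grid D) (int i) (int j)"
    unfolding unblocked_def using h ij le
    by (intro conjI exI[of _ "int h"] exI[of _ "int n"]) auto
next
  assume "unblocked (grid D) (int i) (int j)"
  then obtain h where h: "h < int i" "(h, int j) \<notin> grid D" and ij: "(int i, int j) \<in> grid D"
    unfolding unblocked_def by auto
  then show "movable D i j"
    unfolding movable_def by (auto simp: grid_not_mem intro!: bexI[of _ "nat h"])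
qed

text \<open>The extrema are taken over nonempty sets: movability gives the bump above, the staircase
  bound puts \<open>n\<close> among the candidates for \<open>k\<close>, and \<open>h\<close> and
  \<open>k\<close> themselves are candidates for \<open>a\<close> and \<open>b\<close>.\<close>

lemma move_corner:
  assumes D: "D \<in> RPD w" "w permutes {1..n}" and m: "movable D i j"
  defines "h \<equiv> move_h i j D" and "k \<equiv> move_k n i j D" and "a \<equiv> move_a n i j D" and "b \<equiv> move_b n i j D"
  shows "1 \<le> h" "h < i" "(h, j) \<notin> D" "\<And>x. h < x \<Longrightarrow> x \<le> i \<Longrightarrow> (x, j) \<in> D"
    and "j < k" "k \<le> n" "(i, k) \<notin> D" "\<And>y. j \<le> y \<Longrightarrow> y < k \<Longrightarrow> (i, y) \<in> D"
    and "h \<le> a" "a < i" "\<exists>y. j \<le> y \<and> y \<le> k \<and> (a, y) \<notin> D"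
      "\<And>x y. a < x \<Longrightarrow> x < i \<Longrightarrow> j \<le> y \<Longrightarrow> y \<le> k \<Longrightarrow> (x, y) \<in> D"
    and "j < b" "b \<le> k" "\<exists>x. h \<le> x \<and> x \<le> i \<and> (x, b) \<notin> D"
      "\<And>x y. h \<le> x \<Longrightarrow> x \<le> i \<Longrightarrow> j < y \<Longrightarrow> y < b \<Longrightarrow> (x, y) \<in> D"
proof -
  have ij: "(i, j) \<in> D" using m unfolding movable_def by simp
  have le: "i + j \<le> n" using RPD_staircase[OF D ij] .
  let ?H = "{h \<in> {1..<i}. (h, j) \<notin> D}"
  have H: "finite ?H" "?H \<noteq> {}" using m unfolding movable_def by auto
  have h: "h \<in> ?H" unfolding h_def move_h_def by (rule Max_in[OF H])
  then show h': "1 \<le> h" "h < i" "(h, j) \<notin> D" by auto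
  show "(x, j) \<in> D" if "h < x" "x \<le> i" for x
  proof (rule ccontr)
    assume "(x, j) \<notin> D"
    then have "x \<in> ?H" using that ij h' by (cases "x = i") auto
    then have "x \<le> h" unfolding h_def move_h_def by (rule Max_ge[OF H(1)])
    then show False using that by simp
  qed
  let ?K = "{k \<in> {j+1..n}. (i, k) \<notin> D}"
  have "(i, n) \<notin> D" using RPD_staircase[OF D, of i n] h' by auto
  then have "n \<in> ?K" using le h' by auto
  then have K: "finite ?K" "?K \<noteq> {}" by auto
  have k: "k \<in> ?K" unfolding k_def move_k_def by (rule Min_in[OF K])
  then show k': "j < k" "k \<le> n" "(i, k) \<notin> D" by auto
  show "(i, y) \<in> D" if "j \<le> y" "y < k" for y
  proof (rule ccontr)
    assume "(i, y) \<notin> D"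
    then have "y \<in> ?K" using that ij k' by (cases "y = j") auto
    then have "k \<le> y" unfolding k_def move_k_def by (rule Min_le[OF K(1)])
    then show False using that by simp
  qed
  have R: "Rect n i j D = {h..i} \<times> {j..k}" unfolding Rect_def h_def k_def ..
  let ?A = "{p \<in> {h..<i}. \<exists>q. (p, q) \<in> Rect n i j D - D}"
  have "h \<in> ?A" using h' k' unfolding R by auto
  then have A: "finite ?A" "?A \<noteq> {}" by auto
  have a: "a \<in> ?A" unfolding a_def move_a_def h_def by (rule Max_in[OF A[unfolded h_def]])
  then show a': "h \<le> a" "a < i" "\<exists>y. j \<le> y \<and> y \<le> k \<and> (a, y) \<notin> D" unfolding R by auto
  show "(x, y) \<in> D" if "a < x" "x < i" "j \<le> y" "y \<le> k" for x y
  proof (rule ccontr)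
    assume "(x, y) \<notin> D"
    then have "x \<in> ?A" using that a' unfolding R by auto
    then have "x \<le> a" unfolding a_def move_a_def h_def by (rule Max_ge[OF A(1)[unfolded h_def]])
    then show False using that by simp
  qed
  let ?B = "{q \<in> {j<..k}. \<exists>p. (p, q) \<in> Rect n i j D - D}"
  have "k \<in> ?B" using h' k' unfolding R by (auto intro!: exI[of _ i])
  then have B: "finite ?B" "?B \<noteq> {}" by auto
  have b: "b \<in> ?B" unfolding b_def move_b_def k_def by (rule Min_in[OF B[unfolded k_def]])
  then show b': "j < b" "b \<le> k" "\<exists>x. h \<le> x \<and> x \<le> i \<and> (x, b) \<notin> D" unfolding R by auto
  show "(x, y) \<in> D" if "h \<le> x" "x \<le> i" "j < y" "y < b" for x y
  proof (rule ccontr)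
    assume "(x, y) \<notin> D"
    then have "y \<in> ?B" using that b' unfolding R by auto
    then have "b \<le> y" unfolding b_def move_b_def k_def by (rule Min_le[OF B(1)[unfolded k_def]])
    then show False using that by simp
  qed
qed

lemma ladder_move_eq:
  assumes "ladder_corner D i j h k"
  shows "ladder_move i j D = insert (h, k) (D - {(i, j)})"
proof -
  have "(THE c. ladder_corner D i j (fst c) (snd c)) = (h, k)"
  proof (rule the_equality)
    fix c assume "ladder_corner D i j (fst c) (snd c)"
    from ladder_unique[OF ladder_corner_grid[OF assms] ladder_corner_grid[OF this]]
    show "c = (h, k)" by (cases c) simp
  qed (use assms in simp)
  then show ?thesis unfolding ladder_move_def by simp
qed

text \<open>The outer induction on \<open>row_sum\<close> serves the second call, which runs on the
  result of the first. The inner induction on \<open>i + (n - j)\<close> serves the first call,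
  which stays on \<open>D\<close> but moves up or to the right.\<close>

lemma move_op_moves:
  assumes w: "w permutes {1..n}" and "D \<in> RPD w" and "movable D i j"
  shows "\<exists>E. move_op n i j D = Some E \<and> E \<in> RPD w \<and> row_sum E < row_sum D \<and>
    moves (int i) (int j) (grid D) (grid E)"
  using assms(2,3)
proof (induction "row_sum D" arbitrary: D i j rule: less_induct)
  case less_row: less
  show ?case
    using less_row.prems
  proof (induction "i + (n - j)" arbitrary: i j rule: less_induct)
    case less
    note D = less.prems(1) and m = less.prems(2)
    note RD = RPD_D[OF D]
    let ?h = "move_h i j D" and ?k = "move_k n i j D" and ?a = "move_a n i j D" and ?b = "move_b n i j D"
    note c = move_corner[OF D w m]
    have ij: "(i, j) \<in> D" using m unfolding movable_def by simp
    then have pos: "1 \<le> i" "1 \<le> j" using RD(1) unfolding pipe_dream_def by auto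
    have adm: "admissible (grid D)" using RPD_admissible[OF D] .
    have fr: "unblocked (grid D) (int i) (int j)" using m movable_iff_unblocked[OF D w] by simp
    consider (ladder) "?a = ?h" "?b = ?k" | (row) "?h < ?a" | (col) "?a = ?h" "?b < ?k"
      using c(9,14) by linarith
    then show ?case
    proof cases
      case ladder
      have full: "(x, y) \<in> D" if xy: "?h \<le> x" "x \<le> i" "j \<le> y" "y \<le> ?k" "(x, y) \<notin> {(?h, j), (i, ?k), (?h, ?k)}" for x y
      proof -
        consider "x = i" | "x = ?h" "j < y" "y < ?k" | "?h < x" "x < i" using xy by fastforce
        then show ?thesis
          using xy c(8)[of y] c(12)[of x y] c(16)[of x y] c(2) ladder by cases auto
      qed
      have "(?h, ?k) \<notin> D"
        using RPD_no_double_crossing[OF D c(1,2) pos(2) c(5) ij c(3,7) full] by blast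
      moreover have "{?h..i} \<times> {j..?k} - {(?h, j), (i, ?k), (?h, ?k)} \<subseteq> D"
      proof
        fix e assume "e \<in> {?h..i} \<times> {j..?k} - {(?h, j), (i, ?k), (?h, ?k)}"
        then show "e \<in> D" using full[of "fst e" "snd e"] by (cases e) simp
      qed
      ultimately have lc: "ladder_corner D i j ?h ?k"
        unfolding ladder_corner_def using c(1-3,5,7) pos ij by blast
      then have lm: "ladder_movable D i j" unfolding ladder_movable_def by blast
      let ?E = "insert (?h, ?k) (D - {(i, j)})"
      have "move_op n i j D = Some ?E"
        using ladder m lm ladder_move_eq[OF lc] by (subst move_op.simps) simp
      moreover have "shift (grid D) (int i) (int j) (int ?h) (int ?k) = grid ?E"
        using grid_shift c(1,5) pos by simp
      then have "moves (int i) (int j) (grid D) (grid ?E)"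
        using moves_last[OF ladder_pivot[OF ladder_corner_grid[OF lc]]] by simp
      ultimately show ?thesis using RPD_ladder_corner[OF D lc] row_sum_ladder[OF RD(2) lc] by blast
    next
      case row
      have aj: "(?a, j) \<in> D" using c(4)[of ?a] row c(10) by simp
      then have ma: "movable D ?a j" unfolding movable_def using row c(1,3) by auto
      obtain D1 where D1: "move_op n ?a j D = Some D1" "D1 \<in> RPD w" "row_sum D1 < row_sum D"
        "moves (int ?a) (int j) (grid D) (grid D1)"
        using less.hyps[OF _ D ma] c(10) by auto
      have "unblocked (grid D1) (int i) (int j)"
        by (rule steps_unblocked[OF moves_props(3)[OF D1(4) adm] fr]) (use c(10) in auto)
      then have "movable D1 i j" using movable_iff_unblocked[OF D1(2) w] by simp
      then obtain E where E: "move_op n i j D1 = Some E" "E \<in> RPD w" "row_sum E < row_sum D1"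
        "moves (int i) (int j) (grid D1) (grid E)"
        using less_row.hyps[OF D1(3,2)] by blast
      have "move_op n i j D = Some E"
        using row m D1(1) E(1) by (subst move_op.simps) simp
      moreover have "moves (int i) (int j) (grid D) (grid E)"
      proof -
        obtain y0 where y0: "j \<le> y0" "y0 \<le> ?k" "(?a, y0) \<notin> D" using c(11) by blast
        then have "j < y0" using aj by (cases "y0 = j") auto
        \<comment> \<open>The first bump of row \<open>a\<close> to the right of \<open>j\<close>
          bounds the full block required by \<open>moves_via_row\<close>.\<close>
        define y where "y = (LEAST y. j < y \<and> (?a, y) \<notin> D)"
        have y: "j < y \<and> (?a, y) \<notin> D" unfolding y_def by (rule LeastI[of _ y0]) (use y0 \<open>j < y0\<close> in simp)
        have ymin: "(?a, z) \<in> D" if "j \<le> z" "z < y" for z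
          using not_less_Least[of z "\<lambda>y. j < y \<and> (?a, y) \<notin> D"] that aj unfolding y_def
          by (cases "z = j") auto
        have "y \<le> y0" unfolding y_def by (rule Least_le) (use y0 \<open>j < y0\<close> in simp)
        show ?thesis
        proof (rule moves_via_row[OF D1(4) E(4), of "int y"])
          show "(int ?a, int y) \<notin> grid D" using y row by simp
          fix x z assume xz: "int ?a \<le> x" "x \<le> int i" "int j \<le> z" "z < int y"
          consider "nat x = ?a" | "nat x = i" | "?a < nat x" "nat x < i" using xz by linarith
          then have "(nat x, nat z) \<in> D"
            using xz ymin[of "nat z"] c(8)[of "nat z"] c(12)[of "nat x" "nat z"] \<open>y \<le> y0\<close> y0(2) by cases auto
          then show "(x, z) \<in> grid D" by (simp add: grid_def)
        qed (use c(10) y in auto)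
      qed
      ultimately show ?thesis using E D1(3) by auto
    next
      case col
      have ib: "(i, ?b) \<in> D" using c(8)[of ?b] c(13) col by simp
      \<comment> \<open>As \<open>a = h\<close>, the rows strictly between \<open>h\<close> and
        \<open>i\<close> are full, and \<open>(i, b)\<close> is a cross; so the bump in column
        \<open>b\<close> lies in row \<open>h\<close>.\<close>
      have hb: "(?h, ?b) \<notin> D"
      proof -
        obtain x where x: "?h \<le> x" "x \<le> i" "(x, ?b) \<notin> D" using c(15) by blast
        then show ?thesis using c(12)[of x ?b] ib c(13) col by (cases "x = i"; cases "x = ?h") auto
      qed
      then have mb: "movable D i ?b" unfolding movable_def using c(1,2) ib by auto
      have less_b: "i + (n - ?b) < i + (n - j)" using c(6,13,14) by linarith
      then obtain D1 where D1: "move_op n i ?b D = Some D1" "D1 \<in> RPD w" "row_sum D1 < row_sum D"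
        "moves (int i) (int ?b) (grid D) (grid D1)"
        using less.hyps[OF less_b D mb] by blast
      have "unblocked (grid D1) (int i) (int j)"
        by (rule steps_unblocked[OF moves_props(3)[OF D1(4) adm] fr]) (use c(13) in auto)
      then have "movable D1 i j" using movable_iff_unblocked[OF D1(2) w] by simp
      then obtain E where E: "move_op n i j D1 = Some E" "E \<in> RPD w" "row_sum E < row_sum D1"
        "moves (int i) (int j) (grid D1) (grid E)"
        using less_row.hyps[OF D1(3,2)] by blast
      have "move_op n i j D = Some E"
        using col m D1(1) E(1) by (subst move_op.simps) simp
      moreover have "moves (int i) (int j) (grid D) (grid E)"
      proof (rule moves_via_column[OF D1(4) E(4), of "int ?k" "int ?h"])
        fix x y assume xy: "int ?h < x" "x \<le> int i" "int j \<le> y" "y < int ?k"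
        have "(nat x, nat y) \<in> D"
          using xy c(8)[of "nat y"] c(12)[of "nat x" "nat y"] col by (cases "nat x = i") auto
        then show "(x, y) \<in> grid D" by (simp add: grid_def)
      next
        fix x assume x: "int ?h < x" "x < int i"
        have "(nat x, ?k) \<in> D" using x c(12)[of "nat x" ?k] c(5) col by auto
        then show "(x, int ?k) \<in> grid D" by (simp add: grid_def)
      qed (use c(1,2,3,7,13) col hb pos in auto)
      ultimately show ?thesis using E D1(3) by auto
    qed
  qed
qed

lemma move_op_commute:
  assumes w: "w permutes {1..n}" and D: "D \<in> RPD w" and m: "movable D i j" "movable D p q"
    and "i < p" "j < q"
  shows "\<exists>E. Option.bind (move_op n p q D) (move_op n i j) = Some E \<and>
             Option.bind (move_op n i j D) (move_op n p q) = Some E"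
proof -
  obtain A where A: "move_op n i j D = Some A" "A \<in> RPD w" "moves (int i) (int j) (grid D) (grid A)"
    using move_op_moves[OF w D m(1)] by blast
  obtain B where B: "move_op n p q D = Some B" "B \<in> RPD w" "moves (int p) (int q) (grid D) (grid B)"
    using move_op_moves[OF w D m(2)] by blast
  obtain G where G: "moves (int p) (int q) (grid A) G" "moves (int i) (int j) (grid B) G"
    using moves_commute[OF RPD_admissible[OF D] A(3) B(3)] assms(5,6) by auto
  have "movable A p q" "movable B i j"
    using moves_unblocked[OF G(1)] moves_unblocked[OF G(2)] movable_iff_unblocked w A(2) B(2) by blast+
  then obtain E F where E: "move_op n p q A = Some E" "E \<in> RPD w" "moves (int p) (int q) (grid A) (grid E)"
    and F: "move_op n i j B = Some F" "F \<in> RPD w" "moves (int i) (int j) (grid B) (grid F)"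
    using move_op_moves[OF w A(2)] move_op_moves[OF w B(2)] by meson
  have "grid E = grid F" using moves_unique[OF E(3) G(1)] moves_unique[OF F(3) G(2)] by simp
  then have "E = F" using grid_inj RPD_D(1) E(2) F(2) by blast
  then show ?thesis using A(1) B(1) E(1) F(1) by simp
qed

theorem proposition3p24:
  fixes n i j p q :: nat and w :: "nat \<Rightarrow> nat" and D :: "(nat \<times> nat) set"
  assumes "w permutes {1..n}"
    and "D \<in> RPD w"
    and "movable D i j"
    and "movable D p q"
    and "sw_incomparable (i, j) (p, q)"
  shows "\<exists>E. Option.bind (move_op n p q D) (move_op n i j) = Some E \<and>
             Option.bind (move_op n i j D) (move_op n p q) = Some E"
proof -
  \<comment> \<open>Incomparability means that one cross lies strictly northwest of the other, and
    the claim is symmetric in the two.\<close>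
  consider "i < p" "j < q" | "p < i" "q < j"
    using assms(5) unfolding sw_incomparable_def sw_le_def by fastforce
  then show ?thesis
    using move_op_commute[OF assms(1-4)] move_op_commute[OF assms(1,2,4,3)] by cases blast+
qed

end
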